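(* For each prime $p\equiv 3\pmod 4$ and each integer $k$, let $B_k=B_k^{(p)}$ be the number of curves in $\mathscr{C}_p$ with exactly $k$ affine points over $\mathbb{F}_p$, and let the symmetrized distribution be $$A_k=A_k^{(p)}=\begin{cases}B_k & k\equiv 2\pmod 4,\\ B_{2p-k} & k\equiv 0\pmod 4,\\ 0&\text{otherwise},\end{cases}\qquad 0\le k\le 2p .$$ Then the symmetrized point distribution converges to the normal distribution as $p\to\infty$ through primes $p\equiv3\pmod4$: writing $a_k=A_k/\sum_{j=0}^{2p}A_j$, $\mu=\sum_{k=0}^{2p} k a_k$, $\sigma^2=\sum_{k=0}^{2p}(\mu-k)^2a_k$ and $A^{(p)}(z)=\sum_{k\ge\mu-\sigma z}a_k$, one has $A^{(p)}(z)\to\Phi(z)$ for every real $z$, where $\Phi$ is the cumulative distribution function of the standard normal distribution.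
   Context: For $S\subseteq\mathbb{F}_p$ let $f_S(x)=\prod_{a\in S}(x-a)\in\mathbb{F}_p[x]$ (with $f_\emptyset=1$) and let $X_S(\mathbb{F}_p)=\{(x,y)\in\mathbb{F}_p^2 : y^2=f_S(x)\}$ be the set of affine points of the curve $y^2=f_S(x)$ over $\mathbb{F}_p$ (points at infinity are not counted). $\mathscr{C}_p$ denotes the set of curves $y^2=f_S(x)$ with $S\subseteq\mathbb{F}_p$ and $|S|$ even (one curve for each such $S$), so $B_k$ is the number of even-cardinality subsets $S\subseteq\mathbb{F}_p$ with $|X_S(\mathbb{F}_p)|=k$. *)

theory Defs
  imports "HOL-Probability.Probability" "HOL-Number_Theory.Number_Theory" "HOL-Algebra.UnivPoly"
begin

abbreviation Fp :: "nat \<Rightarrow> int ring"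
  where "Fp p \<equiv> residue_ring (int p)"

abbreviation FpX :: "nat \<Rightarrow> (int, nat \<Rightarrow> int) up_ring"
  where "FpX p \<equiv> UP (Fp p)"

definition root_poly :: "nat \<Rightarrow> int set \<Rightarrow> nat \<Rightarrow> int"
  where "root_poly p S =
    (\<Otimes>\<^bsub>FpX p\<^esub>a\<in>S.
       up_ring.monom (FpX p) \<one>\<^bsub>Fp p\<^esub> 1 \<ominus>\<^bsub>FpX p\<^esub> up_ring.monom (FpX p) a 0)"

definition affine_points :: "nat \<Rightarrow> int set \<Rightarrow> (int \<times> int) set"
  where "affine_points p S =
    {(x, y). x \<in> carrier (Fp p) \<and> y \<in> carrier (Fp p) \<and>
       y [^]\<^bsub>Fp p\<^esub> (2::nat) = UnivPoly.eval (Fp p) (Fp p) id x (root_poly p S)}"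

text \<open>
  A curve \<open>y\<^sup>2 = f\<^sub>S(x)\<close> is represented by its root set \<open>S\<close>; distinct sets give distinct
  polynomials \<open>f\<^sub>S\<close>, hence distinct equations.
\<close>

definition curves :: "nat \<Rightarrow> int set set"
  where "curves p = {S. S \<subseteq> carrier (Fp p) \<and> even (card S)}"

definition curve_count :: "nat \<Rightarrow> int \<Rightarrow> nat"
  where "curve_count p k = card {S \<in> curves p. int (card (affine_points p S)) = k}"

definition sym_count :: "nat \<Rightarrow> int \<Rightarrow> nat"
  where "sym_count p k =
    (if [k = 2] (mod 4) then curve_count p k
     else if [k = 0] (mod 4) then curve_count p (2 * int p - k)
     else 0)"

definition sym_freq :: "nat \<Rightarrow> int \<Rightarrow> real"
  where "sym_freq p k = real (sym_count p k) / real (\<Sum>j\<in>{0..2 * int p}. sym_count p j)"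

definition mu :: "nat \<Rightarrow> real"
  where "mu p = (\<Sum>k\<in>{0..2 * int p}. real_of_int k * sym_freq p k)"

definition sigma :: "nat \<Rightarrow> real"
  where "sigma p = sqrt (\<Sum>k\<in>{0..2 * int p}. (mu p - real_of_int k)\<^sup>2 * sym_freq p k)"

definition upper_dist :: "nat \<Rightarrow> real \<Rightarrow> real"
  where "upper_dist p z =
    (\<Sum>k | k \<in> {0..2 * int p} \<and> real_of_int k \<ge> mu p - sigma p * z. sym_freq p k)"

end

theory Submission
  imports Defs "HOL-Real_Asymp.Real_Asymp"
begin

text \<open>
  The symmetrized counts \<open>A\<^sub>k\<close> are the weight distribution of a binary code of length \<open>2 p\<close>.
  Each even \<open>S\<close> gives the \<open>\<plusminus>1\<close>-word with entries \<open>\<Prod>a\<in>S. h\<^sub>s (x - a)\<close>, indexed by \<open>x\<close> and \<open>s = \<plusminus>1\<close>, where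
  \<open>h\<^sub>s d = s \<chi> d\<close> for \<open>d \<noteq> 0\<close> and \<open>h\<^sub>s 0 = 1\<close>; its entries sum to \<open>2 (|X\<^sub>S| - p)\<close>. The code consists of
  these words and their negatives, and \<open>|X\<^sub>S| \<equiv> 2 (mod 4)\<close> for all even \<open>S\<close>.

  A product of a bounded number of coordinates averages to zero over the code once \<open>p\<close> is large
  (the dual distance tends to infinity): otherwise \<open>a \<mapsto> \<Prod>x\<in>T. \<chi> (x - a)\<close> would be constant up to
  boundedly many \<open>a\<close> for a bounded nonempty \<open>T\<close>, which is impossible because \<open>\<chi> (-1) = -1\<close>.
  Hence for each \<open>m\<close> and large \<open>p\<close> the first \<open>m\<close> moments of the sum of the entries are those of \<open>2 p\<close>
  independent signs. So the characteristic functions are asymptotically equal, and Levy's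
  continuity theorem applies.
\<close>

section \<open>Central limit theorem for signs with vanishing low-order correlations\<close>

text \<open>Expectation under the uniform law, for real and complex values alike. All moment
  computations thus stay finite sums; measures appear only in the passage to the limit law.\<close>

definition avg :: "'w set \<Rightarrow> ('w \<Rightarrow> 'a::real_normed_field) \<Rightarrow> 'a"
  where "avg W f = (\<Sum>w\<in>W. f w) / of_nat (card W)"

lemma avg_cong: "(\<And>w. w \<in> W \<Longrightarrow> f w = g w) \<Longrightarrow> avg W f = avg W g"
  by (simp add: avg_def cong: sum.cong)

lemma avg_sum: "avg W (\<lambda>w. \<Sum>i\<in>I. f i w) = (\<Sum>i\<in>I. avg W (f i))"
  unfolding avg_def by (subst sum.swap) (simp add: sum_divide_distrib)

lemma avg_diff: "avg W f - avg W g = avg W (\<lambda>w. f w - g w)"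
  by (simp add: avg_def sum_subtractf diff_divide_distrib)

lemma avg_cmult: "avg W (\<lambda>w. c * f w) = c * avg W f"
  by (simp add: avg_def sum_distrib_left)

lemma avg_of_real: "avg W (\<lambda>w. of_real (f w)) = of_real (avg W f)"
  by (simp add: avg_def)

lemma avg_mono: "(\<And>w. w \<in> W \<Longrightarrow> f w \<le> g w) \<Longrightarrow> avg W f \<le> avg W g" for f g :: "'w \<Rightarrow> real"
  unfolding avg_def by (intro divide_right_mono sum_mono) auto

lemma norm_avg_le: "norm (avg W f) \<le> avg W (\<lambda>w. norm (f w))"
  unfolding avg_def by (simp add: norm_divide divide_right_mono sum_norm_le)

section \<open>Independent signs, encoded by the subsets of the index set\<close>

definition pm_sign :: "'i set \<Rightarrow> 'i \<Rightarrow> real"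
  where "pm_sign T i = (if i \<in> T then 1 else -1)"

text \<open>Independence of the coordinates: choosing \<open>T\<close> amounts to choosing one
  summand in each factor when the product on the right is expanded.\<close>

lemma sum_Pow_prod_pm_sign:
  fixes g :: "'i \<Rightarrow> real \<Rightarrow> 'a::comm_semiring_1"
  assumes "finite I"
  shows "(\<Sum>T\<in>Pow I. \<Prod>i\<in>I. g i (pm_sign T i)) = (\<Prod>i\<in>I. g i 1 + g i (-1))"
proof -
  have "(\<Prod>i\<in>I. g i (pm_sign T i)) = (\<Prod>i\<in>T. g i 1) * (\<Prod>i\<in>I - T. g i (-1))" if "T \<subseteq> I" for T
  proof -
    have "(\<Prod>i\<in>I. g i (pm_sign T i)) = (\<Prod>i\<in>I - T. g i (pm_sign T i)) * (\<Prod>i\<in>T. g i (pm_sign T i))"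
      by (rule prod.subset_diff[OF that assms])
    then show ?thesis by (simp add: pm_sign_def mult.commute)
  qed
  then show ?thesis unfolding prod_add[OF assms] by (intro sum.cong) auto
qed

text \<open>With factors 1 inserted outside \<open>J\<close>, the product runs over all of
  \<open>I\<close>; every index in \<open>J\<close> then contributes 1 + (-1) = 0.\<close>

lemma avg_prod_pm_sign:
  assumes "finite I" "J \<subseteq> I" "J \<noteq> {}"
  shows "avg (Pow I) (\<lambda>T. \<Prod>i\<in>J. pm_sign T i) = 0"
proof -
  define g where "g i x = (if i \<in> J then x else 1)" for i and x :: real
  have "(\<Prod>i\<in>J. pm_sign T i) = (\<Prod>i\<in>I. g i (pm_sign T i))" for T
  proof -
    have "J = I \<inter> {i. i \<in> J}" using assms by auto
    then show ?thesis using assms(1) by (simp add: g_def flip: prod.inter_restrict)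
  qed
  moreover have "(\<Prod>i\<in>I. g i 1 + g i (-1)) = 0"
    using assms by (auto simp: g_def prod_zero_iff)
  ultimately show ?thesis by (simp add: avg_def sum_Pow_prod_pm_sign assms)
qed

text \<open>The argument is complex so that one computation serves both the characteristic function
  (imaginary \<open>z\<close>) and the exponential moments (real \<open>z\<close>).\<close>

lemma avg_exp_pm_sign:
  fixes z :: complex
  assumes "finite I"
  shows "avg (Pow I) (\<lambda>T. exp (z * of_real (\<Sum>i\<in>I. pm_sign T i))) = cosh z ^ card I"
proof -
  have "exp (z * of_real (\<Sum>i\<in>I. pm_sign T i)) = (\<Prod>i\<in>I. exp (z * of_real (pm_sign T i)))" for T
    using assms by (simp add: sum_distrib_left exp_sum)
  then have "avg (Pow I) (\<lambda>T. exp (z * of_real (\<Sum>i\<in>I. pm_sign T i)))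
      = (\<Prod>i\<in>I. exp z + exp (- z)) / 2 ^ card I"
    using sum_Pow_prod_pm_sign[OF assms, of "\<lambda>i x. exp (z * of_real x)"]
    by (simp add: avg_def card_Pow assms)
  also have "exp z + exp (- z) = 2 * cosh z" by (simp add: cosh_field_def)
  finally show ?thesis by (simp add: power_mult_distrib)
qed

lemma avg_iexp_pm_sign:
  "finite I \<Longrightarrow> avg (Pow I) (\<lambda>T. iexp (t * (\<Sum>i\<in>I. pm_sign T i))) = of_real (cos t ^ card I)"
  using avg_exp_pm_sign[of I "\<i> * of_real t"]
  by (simp add: cosh_conv_cos cos_of_real mult.assoc flip: cos_of_real)

lemma avg_cosh_pm_sign:
  assumes "finite I"
  shows "avg (Pow I) (\<lambda>T. cosh (t * (\<Sum>i\<in>I. pm_sign T i))) = cosh t ^ card I"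
proof -
  let ?S = "\<lambda>T. \<Sum>i\<in>I. pm_sign T i"
  have half: "avg (Pow I) (\<lambda>T. exp (s * ?S T)) = cosh s ^ card I" for s :: real
  proof -
    have "complex_of_real (avg (Pow I) (\<lambda>T. exp (s * ?S T)))
        = avg (Pow I) (\<lambda>T. exp (of_real s * of_real (?S T)))"
      by (simp only: avg_of_real[symmetric] exp_of_real[symmetric] of_real_mult)
    also have "\<dots> = of_real (cosh s ^ card I)"
      by (subst avg_exp_pm_sign[OF assms]) (simp add: cosh_def scaleR_conv_of_real exp_of_real flip: of_real_minus)
    finally show ?thesis using of_real_eq_iff by blast
  qed
  have "avg (Pow I) (\<lambda>T. cosh (t * ?S T))
      = (avg (Pow I) (\<lambda>T. exp (t * ?S T)) + avg (Pow I) (\<lambda>T. exp (- t * ?S T))) / 2"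
    by (simp add: avg_def cosh_field_def sum.distrib add_divide_distrib flip: sum_divide_distrib)
  then show ?thesis unfolding half by simp
qed

section \<open>Equal moments and close characteristic functions\<close>

text \<open>
  The extra factor \<open>\<Prod>i\<in>J. e w i\<close> makes the induction on \<open>m\<close> go through: multiplying it by
  a further sign \<open>e w i\<close> inserts \<open>i\<close> into \<open>J\<close> or removes it.
\<close>

lemma avg_power_sum_mult_prod_eq:
  fixes e1 :: "'w \<Rightarrow> 'i \<Rightarrow> real" and e2 :: "'v \<Rightarrow> 'i \<Rightarrow> real"
  assumes I: "finite I"
    and sq: "\<And>w i. w \<in> W \<Longrightarrow> i \<in> I \<Longrightarrow> e1 w i * e1 w i = 1"
      "\<And>v i. v \<in> V \<Longrightarrow> i \<in> I \<Longrightarrow> e2 v i * e2 v i = 1"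
    and eq: "\<And>J. J \<subseteq> I \<Longrightarrow> card J \<le> M \<Longrightarrow>
      avg W (\<lambda>w. \<Prod>i\<in>J. e1 w i) = avg V (\<lambda>v. \<Prod>i\<in>J. e2 v i)"
    and J: "J \<subseteq> I" "card J + m \<le> M"
  shows "avg W (\<lambda>w. (\<Sum>i\<in>I. e1 w i) ^ m * (\<Prod>i\<in>J. e1 w i))
       = avg V (\<lambda>v. (\<Sum>i\<in>I. e2 v i) ^ m * (\<Prod>i\<in>J. e2 v i))"
  using J
proof (induction m arbitrary: J)
  case 0
  then show ?case using eq by simp
next
  case (Suc m)
  define K where "K i = (if i \<in> J then J - {i} else insert i J)" for i
  have finJ: "finite J" using Suc.prems I finite_subset by blast
  have K: "K i \<subseteq> I" "card (K i) + m \<le> M" if "i \<in> I" for i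
    using that Suc.prems finJ by (auto simp: K_def card_insert_if card_Diff_singleton)
  have step: "avg X (\<lambda>w. (\<Sum>i\<in>I. e w i) ^ Suc m * (\<Prod>i\<in>J. e w i))
      = (\<Sum>i\<in>I. avg X (\<lambda>w. (\<Sum>i\<in>I. e w i) ^ m * (\<Prod>i\<in>K i. e w i)))"
    if e: "\<And>w i. w \<in> X \<Longrightarrow> i \<in> I \<Longrightarrow> e w i * e w i = 1"
    for X :: "'x set" and e :: "'x \<Rightarrow> 'i \<Rightarrow> real"
  proof -
    have "(\<Sum>i\<in>I. e w i) ^ Suc m * (\<Prod>i\<in>J. e w i)
        = (\<Sum>i\<in>I. (\<Sum>i\<in>I. e w i) ^ m * (\<Prod>i\<in>K i. e w i))" if w: "w \<in> X" for w
    proof -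
      have insert: "(\<Prod>i\<in>J. e w i) * e w i = (\<Prod>i\<in>K i. e w i)" if "i \<in> I" for i
      proof (cases "i \<in> J")
        case True
        then have "(\<Prod>i\<in>J. e w i) * e w i = (e w i * e w i) * (\<Prod>i\<in>J - {i}. e w i)"
          using finJ by (simp add: prod.remove mult_ac)
        then show ?thesis using True e[OF w that] by (simp add: K_def)
      qed (use finJ in \<open>simp add: K_def mult.commute\<close>)
      have "(\<Sum>i\<in>I. e w i) ^ Suc m * (\<Prod>i\<in>J. e w i)
          = (\<Sum>i\<in>I. e w i) ^ m * (\<Prod>i\<in>J. e w i) * (\<Sum>i\<in>I. e w i)"
        by (simp add: mult_ac)
      also have "\<dots> = (\<Sum>i\<in>I. (\<Sum>i\<in>I. e w i) ^ m * (\<Prod>i\<in>J. e w i) * e w i)"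
        by (rule sum_distrib_left)
      also have "\<dots> = (\<Sum>i\<in>I. (\<Sum>i\<in>I. e w i) ^ m * (\<Prod>i\<in>K i. e w i))"
        by (rule sum.cong) (simp_all only: mult.assoc insert)
      finally show ?thesis .
    qed
    then have "avg X (\<lambda>w. (\<Sum>i\<in>I. e w i) ^ Suc m * (\<Prod>i\<in>J. e w i))
        = avg X (\<lambda>w. \<Sum>i\<in>I. (\<Sum>i\<in>I. e w i) ^ m * (\<Prod>i\<in>K i. e w i))"
      by (rule avg_cong)
    then show ?thesis by (simp add: avg_sum)
  qed
  show ?case
    using Suc.IH[OF K] by (simp only: step[OF sq(1)] step[OF sq(2)] cong: sum.cong)
qed

text \<open>
  The Taylor polynomials of degree \<open>< 2 q\<close> contribute equally; the remainders are controlled by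
  the moment of order \<open>2 q\<close>, which is in turn at most \<open>(2 q)! (2 t) ^ (-2 q)\<close> times a hyperbolic moment.
\<close>

lemma avg_iexp_diff_le:
  fixes X :: "'w \<Rightarrow> real" and Y :: "'v \<Rightarrow> real"
  assumes mom: "\<And>k. k \<le> 2 * q \<Longrightarrow> avg W (\<lambda>w. X w ^ k) = avg V (\<lambda>v. Y v ^ k)" and q: "q > 0"
  shows "norm (avg W (\<lambda>w. iexp (t * X w)) - avg V (\<lambda>v. iexp (t * Y v)))
    \<le> 2 * (1 / 4) ^ q * avg V (\<lambda>v. cosh (2 * t * Y v))"
proof -
  \<comment> \<open>Taylor degree \<open>2 * q - 1\<close> leaves an error of order
    \<open>2 * q\<close>; this is even, so the absolute value in the remainder becomes a plain
    moment.\<close>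
  define n where "n = 2 * q - 1"
  have n: "Suc n = 2 * q" using q by (simp add: n_def)
  define P where "P x = (\<Sum>k\<le>n. (\<i> * complex_of_real (t * x)) ^ k / fact k)" for x
  have avgP: "avg U (\<lambda>u. P (Z u)) = (\<Sum>k\<le>n. (\<i> * of_real t) ^ k / fact k * of_real (avg U (\<lambda>u. Z u ^ k)))"
    for U :: "'u set" and Z :: "'u \<Rightarrow> real"
  proof -
    have "avg U (\<lambda>u. P (Z u)) = avg U (\<lambda>u. \<Sum>k\<le>n. (\<i> * of_real t) ^ k / fact k * of_real (Z u ^ k))"
      by (intro avg_cong) (simp add: P_def power_mult_distrib mult.assoc)
    then show ?thesis by (simp only: avg_sum avg_cmult avg_of_real)
  qed
  have "avg W (\<lambda>w. P (X w)) = avg V (\<lambda>v. P (Y v))"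
    unfolding avgP using mom n by (intro sum.cong refl) (metis Suc_n_not_le_n atMost_iff le_SucI)
  then have split: "avg W (\<lambda>w. iexp (t * X w)) - avg V (\<lambda>v. iexp (t * Y v))
      = avg W (\<lambda>w. iexp (t * X w) - P (X w)) - avg V (\<lambda>v. iexp (t * Y v) - P (Y v))"
    by (simp flip: avg_diff)
  have rest: "norm (avg U (\<lambda>u. iexp (t * Z u) - P (Z u)))
      \<le> t ^ (2 * q) / fact (2 * q) * avg U (\<lambda>u. Z u ^ (2 * q))"
    for U :: "'u set" and Z :: "'u \<Rightarrow> real"
  proof -
    have "norm (iexp (t * Z u) - P (Z u)) \<le> t ^ (2 * q) / fact (2 * q) * Z u ^ (2 * q)" for u
      using iexp_approx1[of "t * Z u" n]
      by (simp add: P_def n power_mult_distrib power_even_abs abs_mult)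
    then have "avg U (\<lambda>u. norm (iexp (t * Z u) - P (Z u)))
        \<le> avg U (\<lambda>u. t ^ (2 * q) / fact (2 * q) * Z u ^ (2 * q))"
      by (rule avg_mono)
    then show ?thesis
      using order_trans[OF norm_avg_le] by (simp only: avg_cmult)
  qed
  have "norm (avg W (\<lambda>w. iexp (t * X w)) - avg V (\<lambda>v. iexp (t * Y v)))
      \<le> t ^ (2 * q) / fact (2 * q) * avg W (\<lambda>u. X u ^ (2 * q))
        + t ^ (2 * q) / fact (2 * q) * avg V (\<lambda>u. Y u ^ (2 * q))"
    unfolding split by (intro order_trans[OF norm_triangle_ineq4] add_mono rest)
  also have "\<dots> = 2 * avg V (\<lambda>v. t ^ (2 * q) / fact (2 * q) * Y v ^ (2 * q))"
    using mom[of "2 * q"] by (simp only: avg_cmult)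
  also have "\<dots> \<le> 2 * avg V (\<lambda>v. (1 / 4) ^ q * cosh (2 * t * Y v))"
  proof (intro mult_left_mono avg_mono)
    fix v
    \<comment> \<open>All terms of the cosh series are nonnegative, so the term of index
      \<open>2 * q\<close> is at most the sum. Taking the series at \<open>2 * t\<close> instead of
      \<open>t\<close> gains the factor \<open>4 ^ q\<close>.\<close>
    let ?c = "\<lambda>k. if even k then (2 * t * Y v) ^ k /\<^sub>R fact k else 0"
    have "sum ?c {2 * q} \<le> suminf ?c"
      using cosh_converges[of "2 * t * Y v"]
      by (intro sum_le_suminf) (auto simp: sums_iff zero_le_even_power)
    then have "(2 * t * Y v) ^ (2 * q) / fact (2 * q) \<le> cosh (2 * t * Y v)"
      using cosh_converges[of "2 * t * Y v"] by (simp add: sums_iff field_simps)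
    then have "(1 / 4) ^ q * ((2 * t * Y v) ^ (2 * q) / fact (2 * q)) \<le> (1 / 4) ^ q * cosh (2 * t * Y v)"
      by (rule mult_left_mono) simp
    moreover have "(1 / 4) ^ q * (2 * t * Y v) ^ (2 * q) = (t * Y v) ^ (2 * q)"
    proof -
      have "(2 * t * Y v)\<^sup>2 / 4 = (t * Y v)\<^sup>2" by (simp add: power2_eq_square)
      then show ?thesis by (metis (no_types, lifting) mult.commute power_divide power_mult power_one
            times_divide_eq_right mult_1)
    qed
    ultimately have "(t * Y v) ^ (2 * q) / fact (2 * q) \<le> (1 / 4) ^ q * cosh (2 * t * Y v)"
      by (simp only: times_divide_eq_right)
    then show "t ^ (2 * q) / fact (2 * q) * Y v ^ (2 * q) \<le> (1 / 4) ^ q * cosh (2 * t * Y v)"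
      by (simp add: power_mult_distrib)
  qed simp
  finally show ?thesis by (simp add: avg_cmult)
qed

section \<open>Gaussian limits\<close>

lemma cos_power_tendsto: "((\<lambda>n. cos (t / sqrt (real n)) ^ n) \<longlongrightarrow> exp (- (t\<^sup>2) / 2)) at_top"
proof -
  have lim: "((\<lambda>n. cos (t / sqrt (real n)) powr real n) \<longlongrightarrow> exp (- (t\<^sup>2) / 2)) at_top"
    by (real_asymp simp: power2_eq_square)
  have "((\<lambda>n::nat. cos (t / sqrt (real n))) \<longlongrightarrow> 1) at_top" by real_asymp
  then have "\<forall>\<^sub>F n::nat in at_top. cos (t / sqrt (real n)) > 0"
    by (rule order_tendstoD) simp
  \<comment> \<open>\<open>powr\<close> agrees with the power only for a positive base, which the
    cosine is from some \<open>n\<close> on.\<close>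
  then have eq: "\<forall>\<^sub>F n::nat in at_top. cos (t / sqrt (real n)) powr real n = cos (t / sqrt (real n)) ^ n"
    by eventually_elim (rule powr_realpow)
  show ?thesis using lim unfolding tendsto_cong[OF eq] .
qed

lemma cosh_power_tendsto: "((\<lambda>n. cosh (t / sqrt (real n)) ^ n) \<longlongrightarrow> exp (t\<^sup>2 / 2)) at_top"
proof -
  have "((\<lambda>n. cosh (t / sqrt (real n)) powr real n) \<longlongrightarrow> exp (t\<^sup>2 / 2)) at_top"
    by (real_asymp simp: power2_eq_square)
  then show ?thesis by (simp add: powr_realpow cosh_real_pos)
qed

text \<open>Squaring out leaves the diagonal, whose entries are 1. This gives the variance of the
  point distribution.\<close>

lemma avg_square_sum_pm_signs:
  fixes e :: "'w \<Rightarrow> 'i \<Rightarrow> real"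
  assumes W: "finite W" "W \<noteq> {}" and I: "finite I"
    and sq: "\<And>w i. w \<in> W \<Longrightarrow> i \<in> I \<Longrightarrow> e w i * e w i = 1"
    and orth: "\<And>i j. i \<in> I \<Longrightarrow> j \<in> I \<Longrightarrow> i \<noteq> j \<Longrightarrow> avg W (\<lambda>w. e w i * e w j) = 0"
  shows "avg W (\<lambda>w. (\<Sum>i\<in>I. e w i)\<^sup>2) = real (card I)"
proof -
  have pair: "avg W (\<lambda>w. e w i * e w j) = (if i = j then 1 else 0)" if "i \<in> I" "j \<in> I" for i j
  proof (cases "i = j")
    case True
    then have "avg W (\<lambda>w. e w i * e w j) = avg W (\<lambda>w. 1)"
      using sq that by (intro avg_cong) auto
    also have "\<dots> = 1" using W by (simp add: avg_def)
    finally show ?thesis using True by simp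
  qed (use orth that in simp)
  have "avg W (\<lambda>w. (\<Sum>i\<in>I. e w i)\<^sup>2) = (\<Sum>i\<in>I. \<Sum>j\<in>I. avg W (\<lambda>w. e w i * e w j))"
    by (simp add: power2_eq_square sum_product avg_sum)
  also have "\<dots> = (\<Sum>i\<in>I. \<Sum>j\<in>I. if i = j then 1 else 0)"
    using pair by (intro sum.cong) auto
  finally show ?thesis using I by simp
qed

text \<open>For fixed \<open>q\<close> the characteristic function eventually differs from that of
  independent signs by at most \<open>2 * (1 / 4) ^ q * C\<close>. As \<open>C\<close> does not
  depend on \<open>q\<close>, the difference tends to 0.\<close>

lemma avg_pm_signs_tendsto_exp:
  fixes W :: "'a \<Rightarrow> 'w set" and I :: "'a \<Rightarrow> 'i set" and e :: "'a \<Rightarrow> 'w \<Rightarrow> 'i \<Rightarrow> real"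
  assumes W: "\<forall>\<^sub>F a in F. finite (W a) \<and> W a \<noteq> {}"
    and I: "\<forall>\<^sub>F a in F. finite (I a)" "filterlim (\<lambda>a. card (I a)) at_top F"
    and sq: "\<forall>\<^sub>F a in F. \<forall>w\<in>W a. \<forall>i\<in>I a. e a w i * e a w i = 1"
    and orth: "\<And>m. \<forall>\<^sub>F a in F. \<forall>J\<subseteq>I a. J \<noteq> {} \<and> card J \<le> m \<longrightarrow> avg (W a) (\<lambda>w. \<Prod>i\<in>J. e a w i) = 0"
  shows "((\<lambda>a. avg (W a) (\<lambda>w. iexp (t * ((\<Sum>i\<in>I a. e a w i) / sqrt (real (card (I a)))))))
    \<longlongrightarrow> of_real (exp (- (t\<^sup>2) / 2))) F"
proof -
  define N where "N a = sqrt (real (card (I a)))" for a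
  define X where "X a w = (\<Sum>i\<in>I a. e a w i) / N a" for a w
  define Y where "Y a T = (\<Sum>i\<in>I a. pm_sign T i) / N a" for a T
  define \<phi> where "\<phi> a = avg (W a) (\<lambda>w. iexp (t * X a w))" for a
  define \<psi> where "\<psi> a = avg (Pow (I a)) (\<lambda>T. iexp (t * Y a T))" for a
  \<comment> \<open>The cosh moment at \<open>2 * t\<close> converges to the exponential here;
    adding 1 gives an eventual strict upper bound.\<close>
  define C where "C = exp ((2 * t)\<^sup>2 / 2) + 1"
  have \<psi>_eq: "\<forall>\<^sub>F a in F. \<psi> a = of_real (cos (t / N a) ^ card (I a))"
    using I(1)
  proof eventually_elim
    case (elim a)
    show ?case
      using avg_iexp_pm_sign[OF elim, of "t / N a"] by (simp add: \<psi>_def Y_def)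
  qed
  have cosh_eq: "\<forall>\<^sub>F a in F. avg (Pow (I a)) (\<lambda>T. cosh (2 * t * Y a T)) = cosh (2 * t / N a) ^ card (I a)"
    using I(1)
  proof eventually_elim
    case (elim a)
    show ?case
      using avg_cosh_pm_sign[OF elim, of "2 * t / N a"] by (simp add: Y_def)
  qed
  have "((\<lambda>a. cosh (2 * t / N a) ^ card (I a)) \<longlongrightarrow> exp ((2 * t)\<^sup>2 / 2)) F"
    unfolding N_def by (rule filterlim_compose[OF cosh_power_tendsto I(2)])
  then have "\<forall>\<^sub>F a in F. cosh (2 * t / N a) ^ card (I a) < C"
    by (rule order_tendstoD) (simp add: C_def)
  with cosh_eq have cosh_bound: "\<forall>\<^sub>F a in F. avg (Pow (I a)) (\<lambda>T. cosh (2 * t * Y a T)) \<le> C"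
    by eventually_elim simp
  have close: "\<forall>\<^sub>F a in F. norm (\<phi> a - \<psi> a) \<le> 2 * (1 / 4) ^ q * C" if q: "q > 0" for q
    using W I(1) sq orth[of "2 * q"] cosh_bound
  proof eventually_elim
    case (elim a)
    have "avg (W a) (\<lambda>w. X a w ^ k) = avg (Pow (I a)) (\<lambda>T. Y a T ^ k)" if "k \<le> 2 * q" for k
    proof -
      have "avg (W a) (\<lambda>w. \<Prod>i\<in>J. e a w i) = avg (Pow (I a)) (\<lambda>T. \<Prod>i\<in>J. pm_sign T i)"
        if J: "J \<subseteq> I a" "card J \<le> 2 * q" for J
      proof (cases "J = {}")
        case True
        then show ?thesis using elim(1,2) by (simp add: avg_def card_Pow)
      next
        case False
        then show ?thesis using J elim(2,4) avg_prod_pm_sign by metis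
      qed
      then have "avg (W a) (\<lambda>w. (\<Sum>i\<in>I a. e a w i) ^ k * (\<Prod>i\<in>{}. e a w i))
          = avg (Pow (I a)) (\<lambda>T. (\<Sum>i\<in>I a. pm_sign T i) ^ k * (\<Prod>i\<in>{}. pm_sign T i))"
        using elim(2,3) that
        by (intro avg_power_sum_mult_prod_eq[where M = "2 * q"]) (auto simp: pm_sign_def)
      then have "avg (W a) (\<lambda>w. (\<Sum>i\<in>I a. e a w i) ^ k) = avg (Pow (I a)) (\<lambda>T. (\<Sum>i\<in>I a. pm_sign T i) ^ k)"
        by simp
      then show ?thesis
        using avg_cmult[of "W a" "1 / N a ^ k" "\<lambda>w. (\<Sum>i\<in>I a. e a w i) ^ k"]
          avg_cmult[of "Pow (I a)" "1 / N a ^ k" "\<lambda>T. (\<Sum>i\<in>I a. pm_sign T i) ^ k"]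
        by (simp add: X_def Y_def power_divide)
    qed
    then have "norm (\<phi> a - \<psi> a) \<le> 2 * (1 / 4) ^ q * avg (Pow (I a)) (\<lambda>T. cosh (2 * t * Y a T))"
      unfolding \<phi>_def \<psi>_def by (rule avg_iexp_diff_le[OF _ q])
    also have "\<dots> \<le> 2 * (1 / 4) ^ q * C"
      using elim(5) by (intro mult_left_mono) auto
    finally show ?case .
  qed
  have "((\<lambda>a. \<phi> a - \<psi> a) \<longlongrightarrow> 0) F"
  proof (rule tendstoI)
    fix \<epsilon> :: real assume "\<epsilon> > 0"
    moreover have "(\<lambda>q. 2 * (1 / 4) ^ q * C) \<longlonglongrightarrow> 2 * 0 * C"
      by (intro tendsto_intros LIMSEQ_power_zero) simp
    ultimately have "\<forall>\<^sub>F q in at_top. 2 * (1 / 4) ^ q * C < \<epsilon>"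
      by (intro order_tendstoD) auto
    then have "\<forall>\<^sub>F q in at_top. 2 * (1 / 4) ^ q * C < \<epsilon> \<and> q > 0"
      using eventually_gt_at_top[of 0] by eventually_elim simp
    from eventually_happens'[OF sequentially_bot this]
    obtain q where q: "2 * (1 / 4) ^ q * C < \<epsilon>" "q > 0"
      by blast
    show "\<forall>\<^sub>F a in F. dist (\<phi> a - \<psi> a) 0 < \<epsilon>"
      using close[OF q(2)] by eventually_elim (use q(1) in simp)
  qed
  moreover have "(\<psi> \<longlongrightarrow> of_real (exp (- (t\<^sup>2) / 2))) F"
  proof -
    have "((\<lambda>a. cos (t / N a) ^ card (I a)) \<longlongrightarrow> exp (- (t\<^sup>2) / 2)) F"
      unfolding N_def by (rule filterlim_compose[OF cos_power_tendsto I(2)])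
    then have "((\<lambda>a. complex_of_real (cos (t / N a) ^ card (I a))) \<longlongrightarrow> of_real (exp (- (t\<^sup>2) / 2))) F"
      by (rule tendsto_of_real)
    then show ?thesis unfolding tendsto_cong[OF \<psi>_eq] .
  qed
  ultimately have "((\<lambda>a. (\<phi> a - \<psi> a) + \<psi> a) \<longlongrightarrow> 0 + of_real (exp (- (t\<^sup>2) / 2))) F"
    by (rule tendsto_add)
  then show ?thesis by (simp add: \<phi>_def X_def N_def)
qed

section \<open>Convergence of the distribution functions\<close>

text \<open>
  Indices outside \<open>P\<close> are given the limit law, so that Levy's theorem for sequences applies.
\<close>

theorem pm_signs_clt:
  fixes W :: "nat \<Rightarrow> 'w set" and I :: "nat \<Rightarrow> 'i set" and e :: "nat \<Rightarrow> 'w \<Rightarrow> 'i \<Rightarrow> real"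
    and P :: "nat set"
  defines "F \<equiv> inf at_top (principal P)"
  assumes W: "\<And>n. n \<in> P \<Longrightarrow> finite (W n) \<and> W n \<noteq> {}"
    and I: "\<And>n. n \<in> P \<Longrightarrow> finite (I n)" "filterlim (\<lambda>n. card (I n)) at_top F"
    and sq: "\<And>n w i. n \<in> P \<Longrightarrow> w \<in> W n \<Longrightarrow> i \<in> I n \<Longrightarrow> e n w i * e n w i = 1"
    and orth: "\<And>m. \<forall>\<^sub>F n in F. \<forall>J\<subseteq>I n. J \<noteq> {} \<and> card J \<le> m \<longrightarrow> avg (W n) (\<lambda>w. \<Prod>i\<in>J. e n w i) = 0"
  shows "((\<lambda>n. real (card {w \<in> W n. (\<Sum>i\<in>I n. e n w i) / sqrt (real (card (I n))) \<le> z}) / real (card (W n)))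
    \<longlongrightarrow> cdf std_normal_distribution z) F"
proof -
  define X where "X n w = (\<Sum>i\<in>I n. e n w i) / sqrt (real (card (I n)))" for n w
  define M where "M n = (if n \<in> P then distr (measure_pmf (pmf_of_set (W n))) borel (X n)
    else std_normal_distribution)" for n
  have in_P: "\<forall>\<^sub>F n in F. n \<in> P" by (simp add: F_def eventually_inf_principal)
  have M: "real_distribution (M n)" for n
    by (auto simp: M_def real_dist_normal_dist intro!: prob_space.real_distribution_distr measure_pmf.prob_space_axioms)
  have char_M: "char (M n) t = avg (W n) (\<lambda>w. iexp (t * X n w))" if "n \<in> P" for n t
  proof -
    have "char (M n) t = (CLINT w|measure_pmf (pmf_of_set (W n)). iexp (t * X n w))"
      using that by (simp add: M_def char_def integral_distr)
    also have "\<dots> = (\<Sum>w\<in>W n. pmf (pmf_of_set (W n)) w *\<^sub>R iexp (t * X n w))"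
      using W[OF that] by (intro integral_measure_pmf) auto
    also have "\<dots> = avg (W n) (\<lambda>w. iexp (t * X n w))"
      using W[OF that] by (simp add: avg_def scaleR_conv_of_real sum_divide_distrib)
    finally show ?thesis .
  qed
  have "((\<lambda>n. avg (W n) (\<lambda>w. iexp (t * X n w))) \<longlongrightarrow> of_real (exp (- (t\<^sup>2) / 2))) F" for t
    unfolding X_def
  proof (rule avg_pm_signs_tendsto_exp)
    show "\<forall>\<^sub>F n in F. finite (W n) \<and> W n \<noteq> {}" "\<forall>\<^sub>F n in F. finite (I n)"
      "\<forall>\<^sub>F n in F. \<forall>w\<in>W n. \<forall>i\<in>I n. e n w i * e n w i = 1"
      using in_P by (eventually_elim, use W I sq in blast)+
  qed (use I orth in auto)
  then have lim: "((\<lambda>n. char (M n) t) \<longlongrightarrow> char std_normal_distribution t) F" for t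
    using in_P by (subst tendsto_cong[where g = "\<lambda>n. avg (W n) (\<lambda>w. iexp (t * X n w))"])
      (auto simp: char_std_normal_distribution char_M elim: eventually_mono)
  have "(\<lambda>n. char (M n) t) \<longlonglongrightarrow> char std_normal_distribution t" for t
  proof (rule tendstoI)
    fix \<epsilon> :: real assume \<epsilon>: "\<epsilon> > 0"
    have "\<forall>\<^sub>F n in at_top. n \<in> P \<longrightarrow> dist (char (M n) t) (char std_normal_distribution t) < \<epsilon>"
      using tendstoD[OF lim \<epsilon>] by (simp add: F_def eventually_inf_principal)
    then show "\<forall>\<^sub>F n in at_top. dist (char (M n) t) (char std_normal_distribution t) < \<epsilon>"
      by eventually_elim (use \<epsilon> in \<open>auto simp: M_def\<close>)
  qed
  then have "weak_conv_m M std_normal_distribution"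
    by (intro levy_continuity M real_dist_normal_dist)
  \<comment> \<open>The normal law has a density, hence no atoms, so weak convergence yields
    convergence at every \<open>z\<close>.\<close>
  moreover have "isCont (cdf std_normal_distribution) z"
  proof -
    interpret real_distribution std_normal_distribution by (rule real_dist_normal_dist)
    have "emeasure std_normal_distribution {z} = 0"
      by (subst emeasure_density) (auto simp: nn_integral_indicator_singleton)
    then show ?thesis by (simp add: isCont_cdf measure_def)
  qed
  ultimately have "(\<lambda>n. cdf (M n) z) \<longlonglongrightarrow> cdf std_normal_distribution z"
    by (simp add: weak_conv_m_def weak_conv_def)
  then have "((\<lambda>n. cdf (M n) z) \<longlongrightarrow> cdf std_normal_distribution z) F"
    unfolding F_def by (rule tendsto_mono[rotated]) simp
  moreover have "cdf (M n) z = real (card {w \<in> W n. X n w \<le> z}) / real (card (W n))" if "n \<in> P" for n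
    using that W[OF that]
    by (simp add: M_def cdf_def measure_distr measure_pmf_of_set vimage_def Int_def)
  then have "\<forall>\<^sub>F n in F. cdf (M n) z = real (card {w \<in> W n. X n w \<le> z}) / real (card (W n))"
    using in_P by (auto elim: eventually_mono)
  ultimately show ?thesis
    unfolding X_def by (subst (asm) tendsto_cong) assumption+
qed

section \<open>The quadratic character modulo a prime congruent to 3 modulo 4\<close>

locale prime_3_mod_4 =
  fixes p :: nat
  assumes prime_p: "Factorial_Ring.prime p" and p_mod_4: "[p = 3] (mod 4)"
begin

abbreviation chi :: "int \<Rightarrow> int"
  where "chi a \<equiv> Legendre a (int p)"

lemma p_ge_3: "3 \<le> p"
proof -
  have "p mod 4 = 3" using p_mod_4 by (simp add: cong_def)
  then show ?thesis by (metis mod_less_eq_dividend)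
qed

lemma odd_half: "odd ((p - 1) div 2)" and odd_p: "odd p"
proof -
  have "p mod 4 = 3" using p_mod_4 by (simp add: cong_def)
  then show "odd ((p - 1) div 2)" "odd p" by presburger+
qed

lemma chi_cong: "[a = b] (mod int p) \<Longrightarrow> chi a = chi b"
  by (auto simp: Legendre_def QuadRes_def cong_def)

lemma chi_values: "chi a \<in> {-1, 0, 1}"
  by (simp add: Legendre_def)

lemma chi_eq_0_iff: "chi a = 0 \<longleftrightarrow> int p dvd a"
  by (simp add: Legendre_def cong_0_iff)

lemma chi_euler: "[chi a = a ^ ((p - 1) div 2)] (mod int p)"
  using euler_criterion[of p a] prime_p p_ge_3 by simp

text \<open>Two elements of {-1, 0, 1} differ by at most 2 < \<open>p\<close>. This turns Euler's
  congruences into equations between integers.\<close>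

lemma small_cong_eq:
  assumes "[a = b] (mod int p)" "a \<in> {-1, 0, 1}" "b \<in> {-1, 0, 1}"
  shows "a = b"
proof -
  have "int p dvd a - b" using assms(1) by (simp add: cong_iff_dvd_diff)
  moreover have "\<bar>a - b\<bar> < int p" using assms(2,3) p_ge_3 by auto
  ultimately show ?thesis by (metis dvd_imp_le_int eq_iff_diff_eq_0 linorder_not_le abs_of_nat)
qed

lemma chi_mult: "chi (a * b) = chi a * chi b"
proof (rule small_cong_eq)
  have "[chi a * chi b = a ^ ((p - 1) div 2) * b ^ ((p - 1) div 2)] (mod int p)"
    by (intro cong_mult chi_euler)
  then show "[chi (a * b) = chi a * chi b] (mod int p)"
    using chi_euler[of "a * b"] by (metis cong_sym cong_trans power_mult_distrib)
  show "chi a * chi b \<in> {-1, 0, 1}"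
    using chi_values[of a] chi_values[of b] by auto
qed (rule chi_values)

text \<open>Euler's criterion with the odd exponent (p - 1) / 2: here the condition on
  \<open>p\<close> modulo 4 enters the character.\<close>

lemma chi_minus_1: "chi (-1) = -1"
proof (rule small_cong_eq)
  show "[chi (-1) = -1] (mod int p)" using chi_euler[of "-1"] odd_half by simp
qed (auto simp: chi_values[simplified])

lemma chi_uminus: "chi (- a) = - chi a"
  using chi_mult[of "-1" a] chi_minus_1 by simp

lemma chi_1: "chi 1 = 1"
  using chi_mult[of "-1" "-1"] chi_minus_1 by simp

lemma chi_prod: "chi (\<Prod>i\<in>A. f i) = (\<Prod>i\<in>A. chi (f i))"
  by (induction A rule: infinite_finite_induct) (simp_all add: chi_1 chi_mult)

lemma chi_square: "\<not> int p dvd a \<Longrightarrow> chi a * chi a = 1"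
  using chi_values[of a] chi_eq_0_iff[of a] by auto

text \<open>By multiplicativity the product is the character of (p - 1)!, which is -1 modulo
  \<open>p\<close> by Wilson's theorem.\<close>

lemma prod_chi_units: "(\<Prod>x\<in>{1..<int p}. chi x) = -1"
proof -
  have "(\<Prod>x\<in>{1..<int p}. x) = fact (p - 1)"
  proof -
    have "int ` {1..p - 1} = {1..<int p}"
      using p_ge_3 by (simp add: image_int_atLeastAtMost atLeastLessThanPlusOne_atLeastAtMost_int
          of_nat_diff flip: atLeastLessThanPlusOne_atLeastAtMost_int)
    then have "(\<Prod>x\<in>{1..<int p}. x) = (\<Prod>x\<in>{1..p - 1}. int x)"
      by (metis (no_types, lifting) inj_on_of_nat prod.cong prod.reindex_cong)
    then show ?thesis by (simp add: fact_prod)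
  qed
  then have "(\<Prod>x\<in>{1..<int p}. chi x) = chi (fact (p - 1))"
    by (simp flip: chi_prod)
  also have "\<dots> = chi (-1)"
    by (rule chi_cong) (use wilson_theorem[of p] prime_p in simp)
  finally show ?thesis by (simp add: chi_minus_1)
qed

lemma dvd_diff_small:
  assumes "x \<in> {0..<int p}" "y \<in> {0..<int p}" "int p dvd x - y"
  shows "x = y"
proof -
  have "x mod int p = y mod int p" using assms(3) by (simp add: mod_eq_dvd_iff)
  then show ?thesis using assms(1,2) by simp
qed

text \<open>Given one root \<open>y\<close>, all roots are the residues of \<open>y\<close> and
  \<open>- y\<close>, which coincide only for \<open>y = 0\<close> because \<open>p\<close> is
  odd.\<close>

lemma card_square_roots:
  "int (card {y \<in> {0..<int p}. [y\<^sup>2 = c] (mod int p)}) = 1 + chi c"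
proof -
  let ?R = "{y \<in> {0..<int p}. [y\<^sup>2 = c] (mod int p)}"
  have prime: "Factorial_Ring.prime (int p)" using prime_p by simp
  have eqI: "y = z" if "y \<in> {0..<int p}" "z \<in> {0..<int p}" "[y = z] (mod int p)" for y z
    using that by (simp add: cong_def)
  show ?thesis
  proof (cases "\<exists>y. [y\<^sup>2 = c] (mod int p)")
    case False
    then have "?R = {}" by auto
    moreover have "chi c = -1"
      using False unfolding Legendre_def QuadRes_def
      by (metis cong_sym power_zero_numeral)
    ultimately show ?thesis by (simp del: Collect_empty_eq)
  next
    case True
    then obtain y0 where y0: "[y0\<^sup>2 = c] (mod int p)" by blast
    define y where "y = y0 mod int p"
    have y: "y \<in> {0..<int p}" "[y\<^sup>2 = c] (mod int p)"
      using y0 p_ge_3 unfolding y_def by (auto simp: cong_def power_mod)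
    have sol: "[z\<^sup>2 = c] (mod int p) \<longleftrightarrow> [z = y] (mod int p) \<or> [z = - y] (mod int p)" for z
    proof -
      have "[z\<^sup>2 = c] (mod int p) \<longleftrightarrow> [z\<^sup>2 = y\<^sup>2] (mod int p)"
        using y(2) by (meson cong_sym cong_trans)
      also have "\<dots> \<longleftrightarrow> int p dvd (z - y) * (z + y)"
        by (simp add: cong_iff_dvd_diff power2_eq_square algebra_simps)
      also have "\<dots> \<longleftrightarrow> [z = y] (mod int p) \<or> [z = - y] (mod int p)"
        using prime by (simp add: cong_iff_dvd_diff prime_dvd_mult_iff)
      finally show ?thesis .
    qed
    show ?thesis
    proof (cases "y = 0")
      case True
      have "?R = {0}"
        using sol eqI[of _ 0] p_ge_3 True by auto
      moreover have "chi c = 0"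
        using y(2) True by (simp add: chi_eq_0_iff cong_sym_eq[of 0] cong_0_iff)
      ultimately show ?thesis by simp
    next
      case False
      have ny: "int p - y \<in> {0..<int p}" using False y(1) by auto
      have nyc: "[int p - y = - y] (mod int p)" by (simp add: cong_iff_dvd_diff)
      have "?R = {y, int p - y}"
      proof (intro equalityI subsetI)
        fix z assume "z \<in> ?R"
        then have z: "z \<in> {0..<int p}" "[z = y] (mod int p) \<or> [z = - y] (mod int p)"
          using sol by auto
        then show "z \<in> {y, int p - y}"
          using eqI[OF z(1) y(1)] eqI[OF z(1) ny] nyc by (auto simp: cong_def)
      next
        fix z assume "z \<in> {y, int p - y}"
        then show "z \<in> ?R" using y(1) ny nyc sol by auto
      qed
      moreover have "y \<noteq> int p - y" using odd_p by presburger
      moreover have "chi c = 1"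
      proof -
        have "\<not> int p dvd y" using y(1) False by (auto dest: zdvd_imp_le)
        then have "chi (y * y) = 1" using chi_square chi_mult by simp
        then show ?thesis using y(2) chi_cong by (metis power2_eq_square)
      qed
      ultimately show ?thesis by simp
    qed
  qed
qed

section \<open>Products of shifted characters are not constant\<close>

lemma ex_avoiding_residues:
  fixes E :: "int set"
  assumes "finite E" "card E < p"
  obtains a where "\<And>e. e \<in> E \<Longrightarrow> \<not> int p dvd a - e"
proof -
  have "card ((\<lambda>e. e mod int p) ` E) < card {0..<int p}"
    using card_image_le[OF assms(1), of "\<lambda>e. e mod int p"] assms(2) by simp
  then obtain a where a: "a \<in> {0..<int p}" "a \<notin> (\<lambda>e. e mod int p) ` E"
    by (metis assms(1) card_mono finite_imageI linorder_not_le subsetI)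
  have "\<not> int p dvd a - e" if "e \<in> E" for e
  proof
    assume "int p dvd a - e"
    then have "a mod int p = e mod int p" by (simp add: mod_eq_dvd_iff)
    then show False using a that by auto
  qed
  then show thesis using that by blast
qed

text \<open>
  The product of \<open>\<chi> (g x - g y - a)\<close> over all pairs, evaluated row by row, is \<open>c ^ n\<close>;
  evaluated column by column it is \<open>(- c) ^ n\<close>, because \<open>\<chi> (-1) = -1\<close>.
\<close>

lemma odd_family_not_constant:
  fixes g :: "'a \<Rightarrow> int"
  assumes T: "finite T" "odd (card T)" and E: "finite E" "2 * card T * card E < p"
    and c: "c \<noteq> 0"
    and const: "\<And>a. (\<And>e. e \<in> E \<Longrightarrow> \<not> int p dvd a - e) \<Longrightarrow> (\<Prod>x\<in>T. chi (g x - a)) = c"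
  shows False
proof -
  \<comment> \<open>An \<open>a\<close> off \<open>F\<close> modulo \<open>p\<close> keeps all
    \<open>g y + a\<close> and all \<open>g x - a\<close> off \<open>E\<close>, so that
    \<open>const\<close> applies to every row and every column.\<close>
  define F where "F = (\<lambda>(e, y). e - g y) ` (E \<times> T) \<union> (\<lambda>(e, x). g x - e) ` (E \<times> T)"
  have "card F \<le> card (E \<times> T) + card (E \<times> T)"
    unfolding F_def using T E
    by (intro order.trans[OF card_Un_le] add_mono card_image_le) auto
  then have "card F < p" using E by (simp add: card_cartesian_product algebra_simps)
  moreover have "finite F" using T E by (auto simp: F_def)
  ultimately obtain a where a: "\<And>e. e \<in> F \<Longrightarrow> \<not> int p dvd a - e"
    using ex_avoiding_residues by blast
  have row: "(\<Prod>x\<in>T. chi (g x - (g y + a))) = c" if "y \<in> T" for y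
  proof (rule const)
    fix e assume "e \<in> E"
    then have "e - g y \<in> F" using that by (auto simp: F_def)
    then show "\<not> int p dvd g y + a - e" using a by (fastforce simp: algebra_simps)
  qed
  have col: "(\<Prod>y\<in>T. chi (g y - (g x - a))) = c" if "x \<in> T" for x
  proof (rule const)
    fix e assume "e \<in> E"
    then have "g x - e \<in> F" using that by (auto simp: F_def)
    then have "\<not> int p dvd a - (g x - e)" using a by blast
    moreover have "g x - a - e = - (a - (g x - e))" by simp
    ultimately show "\<not> int p dvd g x - a - e" by (metis dvd_minus_iff)
  qed
  have neg: "chi (g x - (g y + a)) = - chi (g y - (g x - a))" for x y
    using chi_uminus[of "g y - (g x - a)"] by (simp add: algebra_simps)
  have "c ^ card T = (\<Prod>y\<in>T. \<Prod>x\<in>T. chi (g x - (g y + a)))"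
    using row by simp
  also have "\<dots> = (\<Prod>x\<in>T. \<Prod>y\<in>T. - chi (g y - (g x - a)))"
    unfolding neg by (rule prod.swap)
  also have "\<dots> = (\<Prod>x\<in>T. - c)"
    using col T by (simp add: prod_uminus)
  \<comment> \<open>The exponent is odd, so the sign survives and forces
    \<open>c = 0\<close>.\<close>
  finally have "c ^ card T = (- c) ^ card T" by simp
  then show False using T c by simp
qed

text \<open>Squaring Euler's criterion gives Fermat's \<open>x ^ (p - 1) = 1\<close>; hence
  \<open>x ^ (p - 2)\<close> is an explicit inverse, as needed for the Moebius substitution.\<close>

lemma mult_inverse_power: "\<not> int p dvd x \<Longrightarrow> [x * x ^ (p - 2) = 1] (mod int p)"
proof -
  assume x: "\<not> int p dvd x"
  have "[chi x * chi x = x ^ ((p - 1) div 2) * x ^ ((p - 1) div 2)] (mod int p)"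
    by (intro cong_mult chi_euler)
  also have "x ^ ((p - 1) div 2) * x ^ ((p - 1) div 2) = x ^ (p - 1)"
    using odd_p by (simp flip: power_add mult_2)
  finally have "[x ^ (p - 1) = 1] (mod int p)"
    using chi_square[OF x] cong_sym by simp
  moreover have "x * x ^ (p - 2) = x ^ (p - 1)"
  proof -
    have "p - 1 = Suc (p - 2)" using p_ge_3 by simp
    then show ?thesis by simp
  qed
  ultimately show ?thesis by simp
qed

text \<open>
  A family of even size is reduced to one of odd size by the Moebius substitution
  \<open>a = t + 1 / b\<close> with \<open>t \<in> T\<close>, which moves the root \<open>t\<close> to infinity.
\<close>

lemma family_not_constant:
  assumes T: "finite T" "T \<noteq> {}"
    and distinct: "\<And>x y. x \<in> T \<Longrightarrow> y \<in> T \<Longrightarrow> int p dvd x - y \<Longrightarrow> x = y"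
    and E: "finite E" "2 * card T * (card E + 1) < p"
    and c: "c \<noteq> 0"
    and const: "\<And>a. (\<And>e. e \<in> E \<Longrightarrow> \<not> int p dvd a - e) \<Longrightarrow> (\<Prod>x\<in>T. chi (x - a)) = c"
  shows False
proof (cases "odd (card T)")
  case True
  show False
  proof (rule odd_family_not_constant[where g = id])
    have "2 * card T * card E \<le> 2 * card T * (card E + 1)" by simp
    then show "2 * card T * card E < p" using E(2) by linarith
  qed (use True T E c const in auto)
next
  case False
  obtain t where t: "t \<in> T" using T by blast
  define U where "U = T - {t}"
  define r where "r x = x ^ (p - 2)" for x :: int
  define c0 where "c0 = (\<Prod>x\<in>U. chi (x - t))"
  have U: "finite U" "card U = card T - 1" "odd (card U)" "card U \<le> card T"
  proof -
    show "finite U" "card U = card T - 1" using T t by (auto simp: U_def)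
    moreover have "card T > 0" using T by (simp add: card_gt_0_iff)
    ultimately show "odd (card U)" "card U \<le> card T" using False by auto
  qed
  have nz: "\<not> int p dvd x - t" if "x \<in> U" for x
    using that distinct[OF _ t] by (auto simp: U_def)
  \<comment> \<open>\<open>r\<close> is inversion modulo \<open>p\<close>. Avoiding 0 makes
    \<open>b\<close> invertible; avoiding 1 / (e - t) keeps t + 1 / b off \<open>E\<close>.\<close>
  define F where "F = insert 0 ((\<lambda>e. r (e - t)) ` E)"
  show False
  proof (rule odd_family_not_constant[where g = "\<lambda>x. r (x - t)" and T = U and E = F and c = "c0 * c"])
    have "card F \<le> card E + 1"
      unfolding F_def using E(1) by (simp add: card_image_le card_insert_le_m1)
    then have "2 * card U * card F \<le> 2 * card T * (card E + 1)"
      using U by (intro mult_le_mono) auto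
    then show "2 * card U * card F < p" using E(2) by linarith
    show "c0 * c \<noteq> 0" using c nz U by (simp add: c0_def chi_eq_0_iff)
    show "finite F" using E by (simp add: F_def)
    fix b assume b: "\<And>e. e \<in> F \<Longrightarrow> \<not> int p dvd b - e"
    then have b0: "\<not> int p dvd b" by (fastforce simp: F_def)
    have rb: "[b * r b = 1] (mod int p)"
      using mult_inverse_power[OF b0] by (simp add: r_def)
    have rb0: "\<not> int p dvd r b"
      using rb prime_p by (meson cong_dvd_iff dvd_mult not_prime_unit prime_nat_int_transfer)
    \<comment> \<open>Multiplying 1 / (x - t) - b by (x - t) / b gives -(x - (t + 1 / b));
      characters of units square to 1, so they can be moved across.\<close>
    have factor: "chi (r (x - t) - b) = - (chi (x - t) * chi (r b) * chi (x - (t + r b)))" if "x \<in> U" for x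
    proof -
      have "[(x - t) * r (x - t) = 1] (mod int p)"
        using mult_inverse_power[OF nz[OF that]] by (simp add: r_def)
      then have "[(x - t) * r (x - t) * r b - (x - t) * (b * r b) = 1 * r b - (x - t) * 1] (mod int p)"
        using rb by (intro cong_diff cong_mult cong_refl)
      then have "[(r (x - t) - b) * ((x - t) * r b) = - (x - (t + r b))] (mod int p)"
        by (simp add: algebra_simps)
      then have "chi (r (x - t) - b) * (chi (x - t) * chi (r b)) = - chi (x - (t + r b))"
        using chi_cong chi_mult chi_uminus by metis
      moreover have "chi (x - t) * chi (x - t) = 1" "chi (r b) * chi (r b) = 1"
        using chi_square nz[OF that] rb0 by auto
      moreover have "u = - (v * w * z)" if "u * (v * w) = - z" "v * v = 1" "w * w = 1" for u v w z :: int
        using that by (metis mult.left_commute mult_cancel_left2 mult_minus_right)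
      ultimately show ?thesis by blast
    qed
    have "(\<Prod>x\<in>T. chi (x - (t + r b))) = c"
    proof (rule const)
      fix e assume e: "e \<in> E"
      show "\<not> int p dvd t + r b - e"
      proof
        assume "int p dvd t + r b - e"
        then have eq: "[e - t = r b] (mod int p)"
          by (metis add.commute cong_iff_dvd_diff cong_sym_eq diff_diff_eq2)
        then have "\<not> int p dvd e - t" using rb0 cong_dvd_iff by blast
        then have "[(e - t) * r (e - t) = 1] (mod int p)"
          using mult_inverse_power by (simp add: r_def)
        moreover have "[(e - t) * r (e - t) = r b * r (e - t)] (mod int p)"
          using eq by (intro cong_mult cong_refl)
        ultimately have "[b * (r b * r (e - t)) = b * 1] (mod int p)"
          by (intro cong_mult cong_refl) (meson cong_sym cong_trans)
        moreover have "[b * r b * r (e - t) = 1 * r (e - t)] (mod int p)"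
          using rb by (intro cong_mult cong_refl)
        ultimately have "[b = r (e - t)] (mod int p)"
          by (metis cong_sym cong_trans mult.assoc mult_1 mult_1_right)
        then show False using b[of "r (e - t)"] e by (simp add: F_def cong_iff_dvd_diff)
      qed
    qed
    \<comment> \<open>The root \<open>t\<close> itself contributes the character of -1 / b.\<close>
    then have c_eq: "c = - chi (r b) * (\<Prod>x\<in>U. chi (x - (t + r b)))"
      using T t chi_uminus[of "r b"] by (simp add: U_def prod.remove)
    have "(\<Prod>x\<in>U. chi (r (x - t) - b))
        = (\<Prod>x\<in>U. (- chi (r b)) * (chi (x - t) * chi (x - (t + r b))))"
      by (rule prod.cong) (simp_all add: factor)
    also have "\<dots> = (- chi (r b)) ^ card U * (c0 * (\<Prod>x\<in>U. chi (x - (t + r b))))"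
      by (simp only: prod.distrib prod_constant c0_def)
    \<comment> \<open>Since \<open>card U\<close> is odd, the power of this sign is the sign itself,
      which \<open>c_eq\<close> absorbs; the result no longer depends on \<open>b\<close>.\<close>
    also have "(- chi (r b)) ^ card U = - chi (r b)"
      using chi_values[of "r b"] rb0 chi_eq_0_iff[of "r b"] U(3) by auto
    also have "- chi (r b) * (c0 * (\<Prod>x\<in>U. chi (x - (t + r b)))) = c0 * c"
      by (simp add: c_eq)
    finally show "(\<Prod>x\<in>U. chi (r (x - t) - b)) = c0 * c" .
  qed (use U in auto)
qed

text \<open>
  As \<open>s\<close> ranges over \<open>1, -1\<close>, the indicators of the two classes (residues, nonresidues), written
  multiplicatively: the value at \<open>0\<close> is \<open>1\<close>, not \<open>0\<close>, so that products over \<open>S\<close> stay \<open>\<plusminus>1\<close>.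
\<close>

definition signed_chi :: "int \<Rightarrow> int \<Rightarrow> int"
  where "signed_chi s d = (if int p dvd d then 1 else s * chi d)"

lemma signed_chi_square: "s \<in> {1, -1} \<Longrightarrow> signed_chi s d * signed_chi s d = 1"
  using chi_square[of d] by (auto simp: signed_chi_def)

lemma signed_chi_cong: "[d = d'] (mod int p) \<Longrightarrow> signed_chi s d = signed_chi s d'"
  using chi_cong[of d d'] by (simp add: signed_chi_def flip: chi_eq_0_iff)

text \<open>Away from the roots, an \<open>x\<close> present with both signs contributes only the
  constant -1. What remains is a product of characters over the set \<open>T\<close> of those
  \<open>x\<close> present with exactly one sign.\<close>

lemma signed_chi_product_not_constant:
  assumes J: "J \<subseteq> {0..<int p} \<times> {1, -1}" "J \<noteq> {}" and small: "2 * card J * (card J + 1) < p"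
  shows "\<exists>a\<in>{0..<int p}. (\<Prod>(x, s)\<in>J. signed_chi s (x - a)) \<noteq> c"
proof (rule ccontr)
  define w where "w a = (\<Prod>(x, s)\<in>J. signed_chi s (x - a))" for a
  assume "\<not> (\<exists>a\<in>{0..<int p}. (\<Prod>(x, s)\<in>J. signed_chi s (x - a)) \<noteq> c)"
  then have const: "w a = c" if "a \<in> {0..<int p}" for a
    using that by (auto simp: w_def)
  have const: "w a = c" for a
  proof -
    have "w a = w (a mod int p)"
      unfolding w_def
      by (intro prod.cong refl)
         (auto intro!: signed_chi_cong simp: cong_def mod_diff_right_eq)
    then show ?thesis using const[of "a mod int p"] p_ge_3 by simp
  qed
  define X where "X s = {x. (x, s) \<in> J}" for s
  define E where "E = fst ` J"
  have finJ: "finite J" using J(1) by (rule finite_subset) auto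
  have X: "finite (X s)" "X s \<subseteq> E" "X s \<subseteq> {0..<int p}" for s
  proof -
    show "X s \<subseteq> E" "X s \<subseteq> {0..<int p}" using J by (force simp: X_def E_def)+
    then show "finite (X s)" using finJ by (auto simp: E_def intro: finite_subset)
  qed
  have E: "finite E" "card E \<le> card J" "E = X 1 \<union> X (-1)"
    using finJ J(1) card_image_le[OF finJ, of fst] by (auto simp: E_def X_def image_iff) force+
  have w: "w a = (\<Prod>x\<in>X 1. signed_chi 1 (x - a)) * (\<Prod>x\<in>X (-1). signed_chi (-1) (x - a))" for a
  proof -
    have "J = X 1 \<times> {1} \<union> X (-1) \<times> {-1}"
      using J(1) by (auto simp: X_def)
    then have "w a = (\<Prod>(x, s)\<in>X 1 \<times> {1}. signed_chi s (x - a))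
        * (\<Prod>(x, s)\<in>X (-1) \<times> {-1}. signed_chi s (x - a))"
      unfolding w_def by (subst prod.union_disjoint[symmetric]) (use X(1) in auto)
    then show ?thesis by (simp flip: prod.cartesian_product)
  qed
  define T where "T = (X 1 - X (-1)) \<union> (X (-1) - X 1)"
  have T: "finite T" "T \<subseteq> E" "T \<subseteq> {0..<int p}" using X unfolding T_def by blast+
  have generic: "w a = (-1) ^ card (X (-1)) * (\<Prod>x\<in>T. chi (x - a))"
    if a: "\<And>e. e \<in> E \<Longrightarrow> \<not> int p dvd a - e" for a
  proof -
    have a': "\<not> int p dvd x - a" if "x \<in> E" for x
      using a[OF that] by (metis dvd_diff_commute)
    have "(\<Prod>x\<in>X s. signed_chi s (x - a)) = s ^ card (X s) * (\<Prod>x\<in>X s. chi (x - a))" for s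
    proof -
      have "(\<Prod>x\<in>X s. signed_chi s (x - a)) = (\<Prod>x\<in>X s. s * chi (x - a))"
        using X(2)[of s] a' by (intro prod.cong) (auto simp: signed_chi_def)
      then show ?thesis by (simp add: prod.distrib)
    qed
    then have "w a = (-1) ^ card (X (-1)) * ((\<Prod>x\<in>X 1. chi (x - a)) * (\<Prod>x\<in>X (-1). chi (x - a)))"
      by (simp add: w)
    also have "(\<Prod>x\<in>X 1. chi (x - a)) * (\<Prod>x\<in>X (-1). chi (x - a))
       = ((\<Prod>x\<in>X 1 - X (-1). chi (x - a)) * (\<Prod>x\<in>X (-1) - X 1. chi (x - a)))
         * (\<Prod>x\<in>X 1 \<inter> X (-1). chi (x - a) * chi (x - a))"
      using prod.Int_Diff[OF X(1)[of 1], of "\<lambda>x. chi (x - a)" "X (-1)"]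
        prod.Int_Diff[OF X(1)[of "-1"], of "\<lambda>x. chi (x - a)" "X 1"]
      by (simp add: prod.distrib Int_commute algebra_simps)
    also have "(\<Prod>x\<in>X 1 \<inter> X (-1). chi (x - a) * chi (x - a)) = 1"
      using a' X(2) by (intro prod.neutral ballI chi_square) blast
    also have "(\<Prod>x\<in>X 1 - X (-1). chi (x - a)) * (\<Prod>x\<in>X (-1) - X 1. chi (x - a)) = (\<Prod>x\<in>T. chi (x - a))"
      unfolding T_def by (rule prod.union_disjoint[symmetric]) (use X in auto)
    finally show ?thesis by simp
  qed
  have cardE: "card E < p"
  proof -
    have "card E * 1 \<le> card J * (2 * (card J + 1))" using E(2) by (intro mult_le_mono) auto
    then show ?thesis using small by (simp add: algebra_simps)
  qed
  obtain a0 where a0: "\<And>e. e \<in> E \<Longrightarrow> \<not> int p dvd a0 - e"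
    using ex_avoiding_residues[OF E(1) cardE] by blast
  have c0: "c \<noteq> 0"
  proof -
    have "\<not> int p dvd x - a0" if "x \<in> T" for x
      using a0 T that by (metis dvd_diff_commute subsetD)
    then show ?thesis
      using generic[OF a0] const[of a0] T by (simp add: chi_eq_0_iff)
  qed
  show False
  proof (cases "T = {}")
    case False
    show False
    proof (rule family_not_constant[of T E "c * (-1) ^ card (X (-1))"])
      have "2 * card T * (card E + 1) \<le> 2 * card J * (card J + 1)"
        using card_mono[OF E(1) T(2)] E(2) by (intro mult_le_mono) auto
      then show "2 * card T * (card E + 1) < p" using small by linarith
      fix a assume "\<And>e. e \<in> E \<Longrightarrow> \<not> int p dvd a - e"
      then have "c = (-1) ^ card (X (-1)) * (\<Prod>x\<in>T. chi (x - a))"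
        using generic const by metis
      then show "(\<Prod>x\<in>T. chi (x - a)) = c * (-1) ^ card (X (-1))"
        by (simp add: algebra_simps flip: power_mult_distrib)
    next
      fix x y assume "x \<in> T" "y \<in> T" "int p dvd x - y"
      then show "x = y" using T(3) by (intro dvd_diff_small) auto
    qed (use False T E c0 in auto)
  next
    \<comment> \<open>Each \<open>x\<close> in \<open>E\<close> occurs with both signs: its pair
      contributes -1 off the root and 1 at it. Moving from the generic \<open>a0\<close> to a root
      \<open>x0\<close> thus changes the exponent of -1 by one.\<close>
    case True
    then have XE: "X s = E" if "s \<in> {1, -1}" for s
      using that E(3) by (auto simp: T_def)
    have "c = (-1) ^ card E"
      using generic[OF a0] const[of a0] True XE by simp
    moreover obtain x0 where x0: "x0 \<in> E" using J by (auto simp: E_def)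
    have "c = (-1) ^ (card E - 1)"
    proof -
      have "c = (\<Prod>x\<in>E. signed_chi 1 (x - x0) * signed_chi (-1) (x - x0))"
        using w[of x0] const[of x0] XE by (simp add: prod.distrib)
      also have "\<dots> = (\<Prod>x\<in>E - {x0}. signed_chi 1 (x - x0) * signed_chi (-1) (x - x0))"
        using E x0 by (subst prod.remove[of _ x0]) (auto simp: signed_chi_def)
      also have "\<dots> = (\<Prod>x\<in>E - {x0}. -1)"
      proof (rule prod.cong)
        fix x assume x: "x \<in> E - {x0}"
        have "\<not> int p dvd x - x0"
          using dvd_diff_small[of x x0] x x0 XE[of 1] X(3)[of 1] by blast
        then show "signed_chi 1 (x - x0) * signed_chi (-1) (x - x0) = -1"
          using chi_square by (simp add: signed_chi_def)
      qed simp
      finally show ?thesis using E x0 by simp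
    qed
    ultimately have "(-1 :: int) ^ card E = (-1) ^ (card E - 1)" by simp
    moreover have "card E > 0" using E x0 by (auto simp: card_gt_0_iff)
    ultimately show False by (cases "card E") auto
  qed
qed

end

section \<open>Point counts\<close>

text \<open>Evaluation at \<open>x\<close> is a ring homomorphism, so it passes through the product
  and acts on each linear factor.\<close>

lemma (in UP_cring) eval_prod_linear_factors:
  assumes x: "x \<in> carrier R" and S: "S \<subseteq> carrier R"
  shows "eval R R id x (\<Otimes>\<^bsub>P\<^esub>a\<in>S. monom P \<one> 1 \<ominus>\<^bsub>P\<^esub> monom P a 0) = (\<Otimes>a\<in>S. x \<ominus> a)"
proof -
  interpret UP_pre_univ_prop R R id by unfold_locales simp
  interpret ev: ring_hom_cring P R "eval R R id x"
    by unfold_locales (use eval_ring_hom[OF x] in simp)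
  have factor: "eval R R id x (monom P \<one> 1 \<ominus>\<^bsub>P\<^esub> monom P a 0) = x \<ominus> a" if "a \<in> S" for a
  proof -
    have a: "a \<in> carrier R" using that S by blast
    then show ?thesis
      using x eval_monom1[OF x] eval_const[OF x a] by (simp add: a_minus_def)
  qed
  have "(\<lambda>a. monom P \<one> 1 \<ominus>\<^bsub>P\<^esub> monom P a 0) \<in> S \<rightarrow> carrier P"
    using S by auto
  then have "eval R R id x (\<Otimes>\<^bsub>P\<^esub>a\<in>S. monom P \<one> 1 \<ominus>\<^bsub>P\<^esub> monom P a 0)
      = (\<Otimes>a\<in>S. (eval R R id x \<circ> (\<lambda>a. monom P \<one> 1 \<ominus>\<^bsub>P\<^esub> monom P a 0)) a)"
    by (rule ev.hom_finprod)
  also have "\<dots> = (\<Otimes>a\<in>S. x \<ominus> a)"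
    by (rule R.finprod_cong') (use factor S x in auto)
  finally show ?thesis .
qed

text \<open>Expanding both products over all subsets, the odd subsets cancel and the even ones are
  counted twice.\<close>

lemma sum_even_subsets_prod:
  fixes w :: "'b \<Rightarrow> int"
  assumes "finite A"
  shows "2 * (\<Sum>S | S \<subseteq> A \<and> even (card S). \<Prod>a\<in>S. w a) = (\<Prod>a\<in>A. 1 + w a) + (\<Prod>a\<in>A. 1 - w a)"
proof -
  have "(\<Prod>a\<in>A. 1 + w a) + (\<Prod>a\<in>A. 1 - w a)
      = (\<Sum>S\<in>Pow A. (\<Prod>a\<in>S. w a) + (-1) ^ card S * (\<Prod>a\<in>S. w a))"
    using prod_add[OF assms, of w "\<lambda>_. 1"] prod_diff_conv_sum[OF assms, of "\<lambda>_. 1" w]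
    by (simp add: sum.distrib add.commute)
  also have "\<dots> = (\<Sum>S\<in>Pow A. if even (card S) then 2 * (\<Prod>a\<in>S. w a) else 0)"
    by (intro sum.cong) auto
  also have "\<dots> = (\<Sum>S | S \<in> Pow A \<and> even (card S). 2 * (\<Prod>a\<in>S. w a))"
    using assms by (subst sum.inter_filter[symmetric]) auto
  finally show ?thesis by (simp add: sum_distrib_left)
qed

context prime_3_mod_4
begin

lemma carrier_Fp: "carrier (Fp p) = {0..<int p}"
  by (auto simp: residue_ring_def)

lemma eval_root_poly:
  assumes x: "x \<in> {0..<int p}" and S: "S \<subseteq> {0..<int p}"
  shows "UnivPoly.eval (Fp p) (Fp p) id x (root_poly p S) = (\<Prod>a\<in>S. x - a) mod int p"
proof -
  interpret residues "int p" "Fp p"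
    using p_ge_3 by unfold_locales auto
  interpret UP_cring "Fp p" "FpX p"
    by unfold_locales auto
  have finS: "finite S" using S finite_subset by blast
  have "x \<ominus>\<^bsub>Fp p\<^esub> a = (x - a) mod int p" for a
    by (simp add: a_minus_def res_add_eq res_neg_eq mod_add_right_eq)
  moreover have "UnivPoly.eval (Fp p) (Fp p) id x (root_poly p S) = (\<Otimes>\<^bsub>Fp p\<^esub>a\<in>S. x \<ominus>\<^bsub>Fp p\<^esub> a)"
    unfolding root_poly_def using x S by (intro eval_prod_linear_factors) (auto simp: carrier_Fp)
  ultimately show ?thesis using prod_cong[OF finS] by simp
qed

lemma affine_points_eq:
  assumes S: "S \<subseteq> {0..<int p}"
  shows "affine_points p S =
    (SIGMA x:{0..<int p}. {y \<in> {0..<int p}. [y\<^sup>2 = (\<Prod>a\<in>S. x - a)] (mod int p)})"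
proof -
  interpret residues "int p" "Fp p"
    using p_ge_3 by unfold_locales auto
  have "y [^]\<^bsub>Fp p\<^esub> (2::nat) = y\<^sup>2 mod int p" if "y \<in> {0..<int p}" for y
    using pow_cong[of y 2] that by simp
  then show ?thesis
    unfolding affine_points_def using eval_root_poly[OF _ S]
    by (auto simp: carrier_Fp cong_def)
qed

text \<open>The fibre over \<open>x\<close> consists of the square roots of the value of the
  polynomial at \<open>x\<close>, so its size is 1 plus the character of that value.\<close>

lemma card_affine_points:
  assumes S: "S \<subseteq> {0..<int p}"
  shows "int (card (affine_points p S)) = int p + (\<Sum>x\<in>{0..<int p}. \<Prod>a\<in>S. chi (x - a))"
proof -
  have "int (card (affine_points p S))
      = (\<Sum>x\<in>{0..<int p}. int (card {y \<in> {0..<int p}. [y\<^sup>2 = (\<Prod>a\<in>S. x - a)] (mod int p)}))"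
    unfolding affine_points_eq[OF S] by (simp add: card_SigmaI del: atLeastLessThan_iff)
  also have "\<dots> = (\<Sum>x\<in>{0..<int p}. 1 + (\<Prod>a\<in>S. chi (x - a)))"
    by (simp only: card_square_roots chi_prod)
  finally show ?thesis by (simp add: sum.distrib)
qed

lemma card_affine_points_le:
  assumes S: "S \<subseteq> {0..<int p}"
  shows "card (affine_points p S) \<le> 2 * p"
proof -
  have "(\<Prod>a\<in>S. chi (x - a)) \<le> 1" for x
    using chi_values[of "\<Prod>a\<in>S. x - a"] by (auto simp: chi_prod)
  then have "(\<Sum>x\<in>{0..<int p}. \<Prod>a\<in>S. chi (x - a)) \<le> (\<Sum>x\<in>{0..<int p}. 1)"
    by (intro sum_mono)
  then show ?thesis using card_affine_points[OF S] by simp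
qed

lemma curves_iff: "S \<in> curves p \<longleftrightarrow> S \<subseteq> {0..<int p} \<and> even (card S)"
  unfolding curves_def carrier_Fp by simp

lemma finite_curves: "finite (curves p)"
proof -
  have "curves p \<subseteq> Pow {0..<int p}" using curves_iff by blast
  then show ?thesis by (rule finite_subset) simp
qed

section \<open>Point counts modulo 4\<close>

lemma prod_chi_pairs:
  assumes "finite S" "\<And>x y. x \<in> S \<Longrightarrow> y \<in> S \<Longrightarrow> x \<noteq> y \<Longrightarrow> \<not> int p dvd x - y"
  shows "(\<Prod>a\<in>S. \<Prod>x\<in>S - {a}. chi (x - a)) = (-1) ^ (card S choose 2)"
  using assms
proof (induction S rule: finite_induct)
  case empty
  then show ?case by (simp add: numeral_2_eq_2)
next
  case (insert b S)
  \<comment> \<open>Each unordered pair of roots contributes -1, because the character is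
    odd.\<close>
  have pair: "chi (b - a) * chi (a - b) = -1" if "a \<in> S" for a
  proof -
    have "\<not> int p dvd b - a" using insert.prems insert.hyps that by (metis insertCI)
    then show ?thesis using chi_uminus[of "b - a"] chi_square[of "b - a"] by simp
  qed
  have "(\<Prod>x\<in>insert b S - {a}. chi (x - a)) = chi (b - a) * (\<Prod>x\<in>S - {a}. chi (x - a))" if "a \<in> S" for a
  proof -
    have "insert b S - {a} = insert b (S - {a})" using insert.hyps that by auto
    then show ?thesis using insert.hyps by simp
  qed
  then have "(\<Prod>a\<in>S. \<Prod>x\<in>insert b S - {a}. chi (x - a))
      = (\<Prod>a\<in>S. chi (b - a)) * (-1) ^ (card S choose 2)"
    using insert.IH insert.prems by (simp add: prod.distrib)
  moreover have "insert b S - {b} = S" using insert.hyps by auto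
  ultimately have "(\<Prod>a\<in>insert b S. \<Prod>x\<in>insert b S - {a}. chi (x - a))
      = (\<Prod>a\<in>S. chi (b - a) * chi (a - b)) * (-1) ^ (card S choose 2)"
    using insert.hyps by (simp add: prod.distrib)
  also have "\<dots> = (-1) ^ (card S + (card S choose 2))"
    using pair by (simp add: power_add)
  also have "card S + (card S choose 2) = (Suc (card S) choose 2)"
    by (simp add: numeral_2_eq_2)
  finally show ?case using insert.hyps by simp
qed

text \<open>
  Count the \<open>x \<notin> S\<close> with \<open>\<chi> (f\<^sub>S x) = -1\<close> modulo 2 through the product of these values,
  exchanging the products over \<open>x\<close> and over the roots.
\<close>

lemma card_affine_points_mod_4:
  assumes "S \<in> curves p"
  shows "int (card (affine_points p S)) mod 4 = 2"
proof -
  have S: "S \<subseteq> {0..<int p}" "even (card S)" "finite S"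
    using assms finite_subset by (auto simp: curves_iff)
  define Z where "Z = {0..<int p}"
  have Z: "finite Z" "S \<subseteq> Z" "card Z = p" using S by (auto simp: Z_def)
  define f where "f x = (\<Prod>a\<in>S. chi (x - a))" for x
  define B where "B = {x \<in> Z - S. f x = -1}"
  have nd: "\<not> int p dvd x - a" if "x \<in> Z" "a \<in> Z" "x \<noteq> a" for x a
    using dvd_diff_small that by (auto simp: Z_def)
  have f0: "f x = 0" if "x \<in> S" for x
  proof -
    have "chi (x - x) = 0" by (simp add: chi_eq_0_iff)
    then show ?thesis unfolding f_def using that S(3) by (meson prod_zero)
  qed
  have f1: "f x = 1 \<or> f x = -1" if "x \<in> Z - S" for x
  proof -
    have "f x \<noteq> 0" unfolding f_def using that Z(2) nd S(3) by (auto simp: chi_eq_0_iff)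
    moreover have "f x \<in> {-1, 0, 1}"
      using chi_values[of "\<Prod>a\<in>S. x - a"] by (simp only: f_def chi_prod)
    ultimately show ?thesis by auto
  qed
  \<comment> \<open>Translation by \<open>a\<close> carries the other residues onto the nonzero
    ones.\<close>
  have column: "(\<Prod>x\<in>Z - {a}. chi (x - a)) = -1" if a: "a \<in> Z" for a
  proof -
    have "(\<Prod>x\<in>Z - {a}. chi (x - a)) = (\<Prod>y\<in>{1..<int p}. chi y)"
    proof (rule prod.reindex_bij_witness[of _ "\<lambda>y. (y + a) mod int p" "\<lambda>x. (x - a) mod int p"])
      fix x assume x: "x \<in> Z - {a}"
      have "(x - a) mod int p \<noteq> 0" using nd[of x a] x a by (simp add: dvd_eq_mod_eq_0)
      moreover have "0 \<le> (x - a) mod int p" "(x - a) mod int p < int p" using p_ge_3 by auto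
      ultimately show "(x - a) mod int p \<in> {1..<int p}" by auto
      show "((x - a) mod int p + a) mod int p = x"
        using x by (simp add: mod_add_left_eq Z_def)
      show "chi ((x - a) mod int p) = chi (x - a)"
        by (rule chi_cong) (simp add: cong_def)
    next
      fix y assume y: "y \<in> {1..<int p}"
      show "((y + a) mod int p - a) mod int p = y"
        using y by (simp add: mod_diff_left_eq)
      then have "(y + a) mod int p \<noteq> a" using y by auto
      then show "(y + a) mod int p \<in> Z - {a}" using p_ge_3 by (simp add: Z_def)
    qed
    then show ?thesis by (simp add: prod_chi_units)
  qed
  have inner: "(\<Prod>x\<in>Z - S. chi (x - a)) = - (\<Prod>x\<in>S - {a}. chi (x - a))" if a: "a \<in> S" for a
  proof -
    have "(\<Prod>x\<in>Z - {a}. chi (x - a)) = (\<Prod>x\<in>Z - S. chi (x - a)) * (\<Prod>x\<in>S - {a}. chi (x - a))"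
    proof -
      have split: "Z - {a} = (Z - S) \<union> (S - {a})" using a Z by auto
      show ?thesis unfolding split by (rule prod.union_disjoint) (use Z S(3) in auto)
    qed
    then have "(\<Prod>x\<in>Z - S. chi (x - a)) * (\<Prod>x\<in>S - {a}. chi (x - a)) = -1"
      using column[of a] a Z by auto
    moreover have "u = - v" if "u * v = -1" for u v :: int
      using that by (auto simp: zmult_eq_neg1_iff)
    ultimately show ?thesis by blast
  qed
  have "(-1) ^ card B = (\<Prod>x\<in>Z - S. f x)"
  proof -
    have "(\<Prod>x\<in>Z - S. f x) = (\<Prod>x\<in>Z - S. if f x = -1 then -1 else 1)"
      using f1 by (intro prod.cong) auto
    also have "\<dots> = (\<Prod>x\<in>B. -1)"
      unfolding B_def using Z(1) by (intro prod.inter_filter[symmetric]) auto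
    finally show ?thesis by simp
  qed
  also have "\<dots> = (\<Prod>a\<in>S. \<Prod>x\<in>Z - S. chi (x - a))"
    unfolding f_def by (rule prod.swap)
  also have "\<dots> = (\<Prod>a\<in>S. - (\<Prod>x\<in>S - {a}. chi (x - a)))"
    by (rule prod.cong) (simp_all add: inner)
  also have "\<dots> = (-1) ^ card S * (\<Prod>a\<in>S. \<Prod>x\<in>S - {a}. chi (x - a))"
    using S(3) by (simp add: prod_uminus)
  \<comment> \<open>\<open>card S\<close> is even, so the signs of the columns cancel and only the
    pairs inside \<open>S\<close> count.\<close>
  also have "\<dots> = (-1) ^ (card S choose 2)"
    using S(2) Z(2) nd by (subst prod_chi_pairs[OF S(3)]) auto
  finally have parity: "even (card B) \<longleftrightarrow> even (card S choose 2)"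
    by (metis neg_one_even_power neg_one_odd_power one_neq_neg_one)
  have "(\<Sum>x\<in>Z. f x) = (\<Sum>x\<in>Z - S. f x)"
    using f0 Z by (intro sum.mono_neutral_right) auto
  also have "\<dots> = (\<Sum>x\<in>Z - S. 1 - 2 * (if f x = -1 then 1 else 0))"
    using f1 by (intro sum.cong) auto
  also have "\<dots> = int (card (Z - S)) - 2 * int (card B)"
    using Z(1) by (simp add: sum_subtractf B_def flip: sum_distrib_left sum.inter_filter)
  also have "int (card (Z - S)) = int p - int (card S)"
    using Z S(3) card_mono[OF Z(1,2)] by (simp add: card_Diff_subset)
  finally have "int (card (affine_points p S)) = 2 * int p - int (card S) - 2 * int (card B)"
    using card_affine_points[OF S(1)] by (simp add: f_def Z_def)
  \<comment> \<open>With |S| = 2 s the count is 2 p - 2 (s + |B|). Here |B| has the parity of s (2 s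
    - 1), hence of s, so the count is 2 p modulo 4, which is 2 as \<open>p\<close> is odd.\<close>
  moreover obtain s where s: "card S = 2 * s" using S(2) by blast
  moreover have "even (card S choose 2) \<longleftrightarrow> even s"
  proof -
    have "card S choose 2 = s * (2 * s - 1)" by (simp add: s choose_two)
    then show ?thesis by (simp only:) (cases s, auto)
  qed
  ultimately show ?thesis using parity odd_p by presburger
qed

section \<open>Codewords and their correlations\<close>

definition codeword :: "int set \<Rightarrow> int \<times> int \<Rightarrow> int"
  where "codeword S = (\<lambda>(x, s). \<Prod>a\<in>S. signed_chi s (x - a))"

abbreviation coords :: "(int \<times> int) set"
  where "coords \<equiv> {0..<int p} \<times> {1, -1}"

lemma codeword_square:
  assumes "i \<in> coords"
  shows "codeword S i * codeword S i = 1"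
  using assms signed_chi_square by (auto simp: codeword_def simp flip: prod.distrib intro!: prod.neutral)

text \<open>At \<open>x\<close> outside \<open>S\<close> the two entries agree, since |S| is even.
  At \<open>x\<close> in \<open>S\<close> the factor at the root is 1 and an odd number of signed
  factors remains, so the entries cancel, matching the zero of the polynomial.\<close>

lemma sum_codeword:
  assumes "S \<in> curves p"
  shows "(\<Sum>i\<in>coords. codeword S i) = 2 * (int (card (affine_points p S)) - int p)"
proof -
  have S: "S \<subseteq> {0..<int p}" "even (card S)" "finite S"
    using assms finite_subset by (auto simp: curves_iff)
  have two: "codeword S (x, 1) + codeword S (x, -1) = 2 * (\<Prod>a\<in>S. chi (x - a))"
    if x: "x \<in> {0..<int p}" for x
  proof -
    have chi: "signed_chi s (x - a) = s * chi (x - a)" if "a \<in> S - {x}" for a s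
      using that S(1) x dvd_diff_small[of x a] by (auto simp: signed_chi_def)
    have neg: "(\<Prod>a\<in>S - {x}. signed_chi (-1) (x - a))
        = (-1) ^ card (S - {x}) * (\<Prod>a\<in>S - {x}. signed_chi 1 (x - a))"
      using S(3) chi by (simp add: prod_uminus)
    show ?thesis
    proof (cases "x \<in> S")
      case True
      then have "odd (card (S - {x}))"
        using card.remove[OF S(3) True] S(2) by simp
      moreover have "(\<Prod>a\<in>S. chi (x - a)) = 0"
        using True S(3) by (auto simp: chi_eq_0_iff intro!: bexI[of _ x])
      ultimately show ?thesis
        using True S(3) neg by (simp add: codeword_def prod.remove[of S x] signed_chi_def[of _ 0])
    next
      case False
      then show ?thesis using neg S(2) chi by (simp add: codeword_def)
    qed
  qed
  have "(\<Sum>i\<in>coords. codeword S i) = (\<Sum>x\<in>{0..<int p}. \<Sum>s\<in>{1, -1}. codeword S (x, s))"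
    by (rule sum.cartesian_product')
  also have "\<dots> = (\<Sum>x\<in>{0..<int p}. 2 * (\<Prod>a\<in>S. chi (x - a)))"
    using two by simp
  finally show ?thesis using card_affine_points[OF S(1)] by (simp flip: sum_distrib_left)
qed

text \<open>Exchanging the products makes each summand a product over \<open>S\<close> of signs
  \<open>w a\<close>. As \<open>w\<close> is constantly neither 1 nor -1, it takes both values, and
  both products in \<open>sum_even_subsets_prod\<close> have a zero factor.\<close>

lemma sum_prod_codeword:
  assumes J: "J \<subseteq> coords" "J \<noteq> {}" and small: "2 * card J * (card J + 1) < p"
  shows "(\<Sum>S\<in>curves p. \<Prod>i\<in>J. codeword S i) = 0"
proof -
  define w where "w a = (\<Prod>(x, s)\<in>J. signed_chi s (x - a))" for a
  have "w a * w a = 1" for a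
    unfolding w_def prod.distrib[symmetric]
    using J(1) signed_chi_square by (intro prod.neutral) auto
  then have w: "w a = 1 \<or> w a = -1" for a
    by (metis square_eq_1_iff)
  have "(\<Prod>i\<in>J. codeword S i) = (\<Prod>a\<in>S. w a)" for S
    unfolding w_def codeword_def by (subst prod.swap) (simp add: case_prod_beta)
  then have "2 * (\<Sum>S\<in>curves p. \<Prod>i\<in>J. codeword S i)
      = 2 * (\<Sum>S | S \<subseteq> {0..<int p} \<and> even (card S). \<Prod>a\<in>S. w a)"
    by (simp add: curves_def carrier_Fp)
  also have "\<dots> = (\<Prod>a\<in>{0..<int p}. 1 + w a) + (\<Prod>a\<in>{0..<int p}. 1 - w a)"
    by (rule sum_even_subsets_prod) simp
  also have "(\<Prod>a\<in>{0..<int p}. 1 + w a) = 0"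
    using signed_chi_product_not_constant[OF assms, of 1] w by (force simp: w_def[symmetric] prod_zero_iff)
  also have "(\<Prod>a\<in>{0..<int p}. 1 - w a) = 0"
    using signed_chi_product_not_constant[OF assms, of "-1"] w by (force simp: w_def[symmetric] prod_zero_iff)
  finally show ?thesis by simp
qed

section \<open>The symmetrized distribution as a weight distribution\<close>

text \<open>
  The entries of the words are \<open>\<plusminus>1\<close> instead of bits; \<open>r = -1\<close> gives the translate of the code by the
  all-ones word, and \<open>sym_points\<close> is the Hamming weight.
\<close>

definition words :: "(int set \<times> int) set"
  where "words = curves p \<times> {1, -1}"

definition word :: "int set \<times> int \<Rightarrow> int \<times> int \<Rightarrow> real"
  where "word = (\<lambda>(S, r) i. real_of_int (r * codeword S i))"

definition sym_points :: "int set \<times> int \<Rightarrow> int"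
  where "sym_points = (\<lambda>(S, r). int p - r * (int (card (affine_points p S)) - int p))"

lemma words_finite: "finite words" and words_nonempty: "words \<noteq> {}"
proof -
  show "finite words" by (simp add: words_def finite_curves)
  have "{} \<in> curves p" by (simp add: curves_iff)
  then show "words \<noteq> {}" by (auto simp: words_def)
qed

lemma word_square: "w \<in> words \<Longrightarrow> i \<in> coords \<Longrightarrow> word w i * word w i = 1"
  using codeword_square[of i "fst w"]
  by (cases w) (auto simp: words_def word_def simp flip: of_int_mult)

lemma sum_word:
  assumes "w \<in> words"
  shows "(\<Sum>i\<in>coords. word w i) = 2 * (real p - real_of_int (sym_points w))"
proof -
  obtain S r where w: "w = (S, r)" "S \<in> curves p" using assms by (auto simp: words_def)
  have "(\<Sum>i\<in>coords. word w i) = real_of_int (r * (\<Sum>i\<in>coords. codeword S i))"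
    by (simp add: w word_def sum_distrib_left)
  also have "\<dots> = 2 * (real p - real_of_int (sym_points w))"
    by (simp add: sum_codeword[OF w(2)] w(1) sym_points_def)
  finally show ?thesis .
qed

text \<open>The two values of \<open>r\<close> only multiply the sum over the curves by
  \<open>1 + (-1) ^ card J\<close>.\<close>

lemma avg_prod_word:
  assumes J: "J \<subseteq> coords" "J \<noteq> {}" and small: "2 * card J * (card J + 1) < p"
  shows "avg words (\<lambda>w. \<Prod>i\<in>J. word w i) = 0"
proof -
  have "(\<Sum>w\<in>words. \<Prod>i\<in>J. word w i)
      = (\<Sum>S\<in>curves p. \<Sum>r\<in>{1, -1}. \<Prod>i\<in>J. real_of_int (r * codeword S i))"
    unfolding words_def by (simp add: sum.cartesian_product' word_def)
  also have "\<dots> = (\<Sum>S\<in>curves p. (1 + (-1) ^ card J) * real_of_int (\<Prod>i\<in>J. codeword S i))"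
    by (intro sum.cong) (simp_all add: prod_uminus algebra_simps)
  also have "\<dots> = (1 + (-1) ^ card J) * real_of_int (\<Sum>S\<in>curves p. \<Prod>i\<in>J. codeword S i)"
    by (simp add: sum_distrib_left)
  finally show ?thesis by (simp add: avg_def sum_prod_codeword[OF assms])
qed

lemma sym_points_range: "w \<in> words \<Longrightarrow> sym_points w \<in> {0..2 * int p}"
  using card_affine_points_le[of "fst w"]
  by (cases w) (auto simp: words_def sym_points_def curves_iff)

text \<open>\<open>r = -1\<close> gives the weight |X|, which is 2 modulo 4, and
  \<open>r = 1\<close> gives 2 p - |X|, which is 0 modulo 4. A given weight thus arises from one
  \<open>r\<close> only, matching the cases of \<open>sym_count\<close>.\<close>

lemma sym_count_eq: "sym_count p k = card {w \<in> words. sym_points w = k}"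
proof -
  have p4: "int p mod 4 = 3" using p_mod_4 unfolding cong_def by presburger
  have plus: "sym_points (S, 1) mod 4 = 0" if "S \<in> curves p" for S
    using card_affine_points_mod_4[OF that] p4 unfolding sym_points_def prod.case by presburger
  have minus: "sym_points (S, -1) = int (card (affine_points p S))" for S
    by (simp add: sym_points_def)
  have c4: "[k = 2] (mod 4) \<longleftrightarrow> k mod 4 = 2" "[k = 0] (mod 4) \<longleftrightarrow> k mod 4 = 0" for k :: int
    by (auto simp: cong_def)
  have eq: "{w \<in> words. sym_points w = k}
      = {S \<in> curves p. 2 * int p - int (card (affine_points p S)) = k} \<times> {1}
        \<union> {S \<in> curves p. int (card (affine_points p S)) = k} \<times> {-1}"
    by (auto simp: words_def sym_points_def)
  consider "k mod 4 = 2" | "k mod 4 = 0" | "k mod 4 \<noteq> 2" "k mod 4 \<noteq> 0" by blast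
  then show ?thesis
  proof cases
    case 1
    then have empty: "{S \<in> curves p. 2 * int p - int (card (affine_points p S)) = k} = {}"
      using plus by (auto simp: sym_points_def)
    show ?thesis
      unfolding eq empty sym_count_def c4 curve_count_def using 1 by (simp add: card_cartesian_product)
  next
    case 2
    then have empty: "{S \<in> curves p. int (card (affine_points p S)) = k} = {}"
      unfolding Collect_empty_eq using card_affine_points_mod_4 by (metis zero_neq_numeral)
    have same: "{S \<in> curves p. 2 * int p - int (card (affine_points p S)) = k}
        = {S \<in> curves p. int (card (affine_points p S)) = 2 * int p - k}"
      by auto
    show ?thesis
      unfolding eq empty same sym_count_def c4 curve_count_def using 2 by (simp add: card_cartesian_product)
  next
    case 3
    then have empty: "{w \<in> words. sym_points w = k} = {}"
      unfolding eq using plus card_affine_points_mod_4 by (fastforce simp: sym_points_def)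
    show ?thesis unfolding empty sym_count_def c4 using 3 by simp
  qed
qed

section \<open>Mean, variance and tails as averages over the code\<close>

lemma sum_sym_count:
  fixes g :: "int \<Rightarrow> real"
  shows "(\<Sum>k\<in>{0..2 * int p}. g k * real (sym_count p k)) = (\<Sum>w\<in>words. g (sym_points w))"
proof -
  have "(\<Sum>k\<in>{0..2 * int p}. \<Sum>w\<in>{w \<in> words. sym_points w = k}. g (sym_points w))
      = (\<Sum>w\<in>words. g (sym_points w))"
    using sym_points_range by (intro sum.group words_finite) auto
  moreover have "(\<Sum>w\<in>{w \<in> words. sym_points w = k}. g (sym_points w)) = g k * real (sym_count p k)" for k
    by (simp add: sym_count_eq)
  ultimately show ?thesis by (simp only:)
qed

lemma sum_sym_freq:
  "(\<Sum>k\<in>{0..2 * int p}. g k * sym_freq p k) = avg words (\<lambda>w. g (sym_points w))"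
proof -
  have "real (\<Sum>j\<in>{0..2 * int p}. sym_count p j) = real (card words)"
    using sum_sym_count[of "\<lambda>_. 1"] by simp
  then have "(\<Sum>k\<in>{0..2 * int p}. g k * sym_freq p k)
      = (\<Sum>k\<in>{0..2 * int p}. g k * real (sym_count p k)) / real (card words)"
    unfolding sym_freq_def by (simp add: sum_divide_distrib)
  then show ?thesis by (simp add: sum_sym_count avg_def)
qed

text \<open>The bound 4 is \<open>2 * card J * (card J + 1)\<close> for a singleton
  \<open>J\<close>.\<close>

lemma avg_sum_word:
  assumes "4 < p"
  shows "avg words (\<lambda>w. \<Sum>i\<in>coords. word w i) = 0"
proof -
  have "avg words (\<lambda>w. word w i) = 0" if "i \<in> coords" for i
    using avg_prod_word[of "{i}"] that assms by simp
  then show ?thesis by (simp add: avg_sum)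
qed

lemma mu_eq:
  assumes "4 < p"
  shows "mu p = real p"
proof -
  have "mu p = avg words (\<lambda>w. real_of_int (sym_points w))"
    unfolding mu_def by (rule sum_sym_freq)
  moreover have "avg words (\<lambda>w. real p - real_of_int (sym_points w)) = 0"
  proof -
    have "avg words (\<lambda>w. 2 * (real p - real_of_int (sym_points w))) = 0"
      using avg_sum_word[OF assms] sum_word by (simp cong: avg_cong)
    then have "2 * avg words (\<lambda>w. real p - real_of_int (sym_points w)) = 0"
      by (simp only: avg_cmult)
    then show ?thesis by simp
  qed
  moreover have "avg words (\<lambda>w. real p) = real p"
    using words_finite words_nonempty by (simp add: avg_def)
  ultimately show ?thesis by (simp flip: avg_diff)
qed

lemma card_coords: "card coords = 2 * p"
  by (simp add: card_cartesian_product)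

text \<open>Two-element sets \<open>J\<close> require \<open>p\<close> above 2 * 2 * 3 = 12. The
  entries sum to twice the deviation of the weight from \<open>p\<close>, up to sign, so their
  second moment 2 p is four times the variance.\<close>

lemma sigma_eq:
  assumes "12 < p"
  shows "sigma p = sqrt (real (2 * p)) / 2"
proof -
  have "avg words (\<lambda>w. (\<Sum>i\<in>coords. word w i)\<^sup>2) = real (card coords)"
  proof (rule avg_square_sum_pm_signs)
    fix i j assume ij: "i \<in> coords" "j \<in> coords" "i \<noteq> j"
    then show "avg words (\<lambda>w. word w i * word w j) = 0"
      using avg_prod_word[of "{i, j}"] assms by simp
  qed (use words_finite words_nonempty word_square in auto)
  moreover have "avg words (\<lambda>w. (\<Sum>i\<in>coords. word w i)\<^sup>2)
      = avg words (\<lambda>w. 4 * (real p - real_of_int (sym_points w))\<^sup>2)"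
    by (rule avg_cong) (simp only: sum_word power_mult_distrib, simp)
  ultimately have "avg words (\<lambda>w. (real p - real_of_int (sym_points w))\<^sup>2) = real (2 * p) / 2\<^sup>2"
    by (simp only: avg_cmult card_coords) simp
  moreover have "(\<Sum>k\<in>{0..2 * int p}. (mu p - real_of_int k)\<^sup>2 * sym_freq p k)
      = avg words (\<lambda>w. (real p - real_of_int (sym_points w))\<^sup>2)"
    using assms by (simp add: sum_sym_freq mu_eq)
  ultimately have "sigma p = sqrt (real (2 * p) / 2\<^sup>2)"
    unfolding sigma_def by simp
  then show ?thesis by (simp only: real_sqrt_divide real_sqrt_power) simp
qed

text \<open>The sum of the entries decreases as the weight grows, so the upper tail of the weights
  is the lower tail of the normalized sum.\<close>

lemma upper_dist_eq:
  assumes "12 < p"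
  shows "upper_dist p z =
    real (card {w \<in> words. (\<Sum>i\<in>coords. word w i) / sqrt (real (card coords)) \<le> z}) / real (card words)"
proof -
  let ?c = "mu p - sigma p * z"
  have pos: "sqrt (real (card coords)) > 0" using assms by (simp add: card_coords)
  have "upper_dist p z = (\<Sum>k\<in>{0..2 * int p}. (if real_of_int k \<ge> ?c then 1 else 0) * sym_freq p k)"
    unfolding upper_dist_def by (subst sum.inter_filter) (auto intro: sum.cong)
  also have "\<dots> = avg words (\<lambda>w. if real_of_int (sym_points w) \<ge> ?c then 1 else 0)"
    by (rule sum_sym_freq)
  also have "\<dots> = real (card {w \<in> words. real_of_int (sym_points w) \<ge> ?c}) / real (card words)"
    using words_finite by (simp add: avg_def flip: sum.inter_filter)
  also have "{w \<in> words. real_of_int (sym_points w) \<ge> ?c}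
      = {w \<in> words. (\<Sum>i\<in>coords. word w i) / sqrt (real (card coords)) \<le> z}"
  proof (rule Collect_cong, rule conj_cong[OF refl])
    fix w assume "w \<in> words"
    then have "(\<Sum>i\<in>coords. word w i) / sqrt (real (card coords)) \<le> z
        \<longleftrightarrow> 2 * (real p - real_of_int (sym_points w)) \<le> z * sqrt (real (card coords))"
      using pos by (simp add: sum_word pos_divide_le_eq)
    also have "\<dots> \<longleftrightarrow> real_of_int (sym_points w) \<ge> real p - sqrt (real (2 * p)) / 2 * z"
      unfolding card_coords by (auto simp: field_simps)
    also have "real p - sqrt (real (2 * p)) / 2 * z = ?c"
      using assms by (simp add: mu_eq sigma_eq)
    finally show "real_of_int (sym_points w) \<ge> ?c
      \<longleftrightarrow> (\<Sum>i\<in>coords. word w i) / sqrt (real (card coords)) \<le> z" by simp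
  qed
  finally show ?thesis .
qed

end

theorem mainTheorem5:
  fixes z :: real
  shows "((\<lambda>p::nat. upper_dist p z) \<longlongrightarrow> cdf std_normal_distribution z)
    (inf at_top (principal {p::nat. Factorial_Ring.prime p \<and> [p = 3] (mod 4)}))"
proof -
  define P where "P = {p::nat. Factorial_Ring.prime p \<and> [p = 3] (mod 4)}"
  let ?F = "inf at_top (principal P)"
  let ?I = "\<lambda>p::nat. {0..<int p} \<times> {1, -1::int}"
  have P: "prime_3_mod_4 p" if "p \<in> P" for p
    using that by unfold_locales (auto simp: P_def)
  have large: "\<forall>\<^sub>F p in ?F. p \<in> P \<and> n < p" for n
    unfolding eventually_inf_principal
    using eventually_gt_at_top[of n] by eventually_elim simp
  have "((\<lambda>p. real (card {w \<in> prime_3_mod_4.words p.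
      (\<Sum>i\<in>?I p. prime_3_mod_4.word p w i) / sqrt (real (card (?I p))) \<le> z}) / real (card (prime_3_mod_4.words p)))
      \<longlongrightarrow> cdf std_normal_distribution z) ?F"
  proof (rule pm_signs_clt)
    show "filterlim (\<lambda>p. card (?I p)) at_top ?F"
    proof (rule filterlim_mono[OF _ order_refl inf_le1])
      show "filterlim (\<lambda>p. card (?I p)) at_top at_top"
        unfolding filterlim_at_top
      proof
        fix Z :: nat
        show "\<forall>\<^sub>F p in at_top. Z \<le> card (?I p)"
          using eventually_ge_at_top[of Z] by eventually_elim (simp add: card_cartesian_product)
      qed
    qed
    fix m
    show "\<forall>\<^sub>F p in ?F. \<forall>J\<subseteq>?I p. J \<noteq> {} \<and> card J \<le> m \<longrightarrow>
        avg (prime_3_mod_4.words p) (\<lambda>w. \<Prod>i\<in>J. prime_3_mod_4.word p w i) = 0"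
      \<comment> \<open>This threshold dominates \<open>2 * card J * (card J + 1)\<close> for all
        \<open>J\<close> with at most \<open>m\<close> elements.\<close>
      using large[of "2 * m * (m + 1)"]
    proof eventually_elim
      case (elim p)
      then interpret prime_3_mod_4 p using P by blast
      show ?case
      proof (intro allI impI)
        fix J assume J: "J \<subseteq> coords" "J \<noteq> {} \<and> card J \<le> m"
        then have "2 * card J * (card J + 1) \<le> 2 * m * (m + 1)" by (intro mult_le_mono) auto
        then show "avg words (\<lambda>w. \<Prod>i\<in>J. word w i) = 0"
          using J elim by (intro avg_prod_word) auto
      qed
    qed
  next
    fix p w i assume "p \<in> P" "w \<in> prime_3_mod_4.words p" "i \<in> ?I p"
    then show "prime_3_mod_4.word p w i * prime_3_mod_4.word p w i = 1"
      using prime_3_mod_4.word_square[OF P] by blast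
  qed (use prime_3_mod_4.words_finite[OF P] prime_3_mod_4.words_nonempty[OF P] in auto)
  moreover have "\<forall>\<^sub>F p in ?F. upper_dist p z = real (card {w \<in> prime_3_mod_4.words p.
      (\<Sum>i\<in>?I p. prime_3_mod_4.word p w i) / sqrt (real (card (?I p))) \<le> z}) / real (card (prime_3_mod_4.words p))"
    using large[of 12] by eventually_elim (use P prime_3_mod_4.upper_dist_eq in blast)
  ultimately show ?thesis
    unfolding P_def[symmetric] by (subst tendsto_cong) assumption+
qed

end
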